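(* Let $n\geq 1$, $p>2$, $0<\sigma<1$ and $\alpha>0$. Assume that a sequence of nonnegative functions $\{u_i\}\subset \mathcal{L}_{\sigma p}(\mathbb{R}^n)\cap C^{\sigma p+\alpha}_{loc}(\mathbb{R}^n)$ converges in $C^{\sigma p+\alpha}_{loc}(\mathbb{R}^n)$ to a function $u\in\mathcal{L}_{\sigma p}(\mathbb{R}^n)$, and that $\{(-\Delta)^\sigma_p u_i\}$ converges pointwise in $\mathbb{R}^n$. Then for any $x\in\mathbb{R}^n$, $$\lim_{i\to\infty}(-\Delta)^\sigma_p u_i(x)=(-\Delta)^\sigma_p u(x)-\theta,$$ where $\theta$ is a nonnegative constant (independent of $x$) given by $$\theta=c_{n,\sigma p}\lim_{R\to\infty}\lim_{i\to\infty}\int_{B_R^c}\frac{u_i^{p-1}(x)}{|x|^{n+\sigma p}}\,dx.$$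
   Context: For $n\ge 1$, $p\geq 2$, $0<\sigma<1$, the fractional $p$-Laplacian is $$(-\Delta)^{\sigma}_{p}u(x)=c_{n,\sigma p}\,\mathrm{P.V.}\int_{\mathbb{R}^{n}}\frac{|u(x)-u(y)|^{p-2}(u(x)-u(y))}{|x-y|^{n+\sigma p}}\,dy,$$ where $c_{n,\sigma p}$ is a fixed positive constant and P.V. denotes the Cauchy principal value (the limit as $\varepsilon\to0^+$ of the integral over $\mathbb{R}^n\setminus B_\varepsilon(x)$). It is well defined for $u\in C^{\sigma p+\alpha}_{loc}(\mathbb{R}^n)\cap\mathcal{L}_{\sigma p}(\mathbb{R}^n)$ with $\alpha>0$. Here $$\mathcal{L}_{\sigma p}(\mathbb{R}^{n}):=\left\{u\in L^{p-1}_{loc}(\mathbb{R}^{n})\,:\,\int_{\mathbb{R}^{n}}\frac{|u(x)|^{p-1}}{1+|x|^{n+\sigma p}}\,dx<\infty\right\},$$ and $C^{\sigma p+\alpha}_{loc}:=C^{[\sigma p+\alpha],\,\sigma p+\alpha-[\sigma p+\alpha]}_{loc}$, where $[\sigma p+\alpha]$ is the integer part of $\sigma p+\alpha$. Functions are real-valued. $B_R=B_R(0)$ is the ball of radius $R$ centered at the origin and $B_R^c=\mathbb{R}^n\setminus B_R$. Pointwise convergence means convergence to a finite limit at every point. *)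

theory Defs
  imports "HOL-Analysis.Analysis"
begin

text \<open>Throughout, the type \<open>'a::euclidean_space\<close> plays the role of the Euclidean space
  \<open>R^n\<close>, with \<open>n = DIM('a) \<ge> 1\<close>.\<close>

definition partial_deriv :: "'a::euclidean_space \<Rightarrow> ('a \<Rightarrow> real) \<Rightarrow> 'a \<Rightarrow> real" where
  "partial_deriv b f x = frechet_derivative f (at x) b"

text \<open>A list \<open>bs\<close> of basis vectors encodes an iterated partial derivative of order
  \<open>length bs\<close>.  A multi-index may be encoded by several lists; for \<open>C^k\<close> functions they give
  the same derivative.\<close>

definition iter_partial :: "'a::euclidean_space list \<Rightarrow> ('a \<Rightarrow> real) \<Rightarrow> 'a \<Rightarrow> real" where
  "iter_partial bs f = fold partial_deriv bs f"

primrec Ck :: "nat \<Rightarrow> ('a::euclidean_space \<Rightarrow> real) \<Rightarrow> bool" where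
  "Ck 0 f \<longleftrightarrow> continuous_on UNIV f"
| "Ck (Suc k) f \<longleftrightarrow> f differentiable_on UNIV \<and> (\<forall>b\<in>Basis. Ck k (partial_deriv b f))"

definition holder_seminorm :: "real \<Rightarrow> 'a::euclidean_space set \<Rightarrow> ('a \<Rightarrow> real) \<Rightarrow> ennreal" where
  "holder_seminorm \<gamma> K f =
     (SUP (x, y) \<in> {(x, y). x \<in> K \<and> y \<in> K \<and> x \<noteq> y}.
        ennreal (\<bar>f x - f y\<bar> / norm (x - y) powr \<gamma>))"

text \<open>The norm of \<open>C^{k,\<gamma>}(K)\<close>.  It takes values in \<open>ennreal\<close>, so that unbounded suprema are
  \<open>\<infinity>\<close>.  For \<open>\<gamma> = 0\<close> the seminorm part is at most twice the supremum part, so that \<open>C^{k,0}\<close>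
  is \<open>C^k\<close> with its usual topology.\<close>

definition holder_norm ::
    "nat \<Rightarrow> real \<Rightarrow> 'a::euclidean_space set \<Rightarrow> ('a \<Rightarrow> real) \<Rightarrow> ennreal" where
  "holder_norm k \<gamma> K f =
     (\<Sum>bs | set bs \<subseteq> Basis \<and> length bs \<le> k. SUP x\<in>K. ennreal \<bar>iter_partial bs f x\<bar>)
     + (\<Sum>bs | set bs \<subseteq> Basis \<and> length bs = k. holder_seminorm \<gamma> K (iter_partial bs f))"

definition holder_loc :: "nat \<Rightarrow> real \<Rightarrow> ('a::euclidean_space \<Rightarrow> real) set" where
  "holder_loc k \<gamma> = {f. Ck k f \<and> (\<forall>K. compact K \<longrightarrow> holder_norm k \<gamma> K f < \<infinity>)}"

definition holder_loc_tendsto ::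
    "nat \<Rightarrow> real \<Rightarrow> (nat \<Rightarrow> 'a::euclidean_space \<Rightarrow> real) \<Rightarrow> ('a \<Rightarrow> real) \<Rightarrow> bool" where
  "holder_loc_tendsto k \<gamma> u v \<longleftrightarrow>
     (\<forall>i. u i \<in> holder_loc k \<gamma>) \<and> v \<in> holder_loc k \<gamma> \<and>
     (\<forall>K. compact K \<longrightarrow> (\<lambda>i. holder_norm k \<gamma> K (\<lambda>x. u i x - v x)) \<longlonglongrightarrow> 0)"

text \<open>\<open>C^s_loc = C^{[s], s - [s]}_loc\<close> for real \<open>s \<ge> 0\<close>, and convergence in this space (the limit
  being a member of the space).\<close>

definition C_loc :: "real \<Rightarrow> ('a::euclidean_space \<Rightarrow> real) set" where
  "C_loc s = holder_loc (nat \<lfloor>s\<rfloor>) (s - of_int \<lfloor>s\<rfloor>)"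

definition C_loc_tendsto ::
    "real \<Rightarrow> (nat \<Rightarrow> 'a::euclidean_space \<Rightarrow> real) \<Rightarrow> ('a \<Rightarrow> real) \<Rightarrow> bool" where
  "C_loc_tendsto s u v \<longleftrightarrow> holder_loc_tendsto (nat \<lfloor>s\<rfloor>) (s - of_int \<lfloor>s\<rfloor>) u v"

definition L_loc :: "real \<Rightarrow> ('a::euclidean_space \<Rightarrow> real) set" where
  "L_loc q = {u. u \<in> borel_measurable lebesgue \<and>
     (\<forall>K. compact K \<longrightarrow> set_integrable lebesgue K (\<lambda>x. \<bar>u x\<bar> powr q))}"

text \<open>The tail space \<open>\<L>_{\<sigma> p}(R^n)\<close>; it depends on \<open>p\<close> also through the exponent \<open>p - 1\<close>.\<close>

definition tail_space :: "real \<Rightarrow> real \<Rightarrow> ('a::euclidean_space \<Rightarrow> real) set" where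
  "tail_space \<sigma> p = {u. u \<in> L_loc (p - 1) \<and>
     integrable lebesgue
       (\<lambda>x. \<bar>u x\<bar> powr (p - 1) / (1 + norm x powr (real DIM('a) + \<sigma> * p)))}"

text \<open>The constant \<open>c\<close> stands for \<open>c_{n,\<sigma> p}\<close>.\<close>

definition frac_p_laplacian ::
    "real \<Rightarrow> real \<Rightarrow> real \<Rightarrow> ('a::euclidean_space \<Rightarrow> real) \<Rightarrow> 'a \<Rightarrow> real" where
  "frac_p_laplacian c \<sigma> p u x =
     c * Lim (at_right 0) (\<lambda>\<epsilon>. LINT y : - ball x \<epsilon> | lebesgue.
           \<bar>u x - u y\<bar> powr (p - 2) * (u x - u y) / norm (x - y) powr (real DIM('a) + \<sigma> * p))"

end

theory Submission
  imports Defs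
begin

text \<open>Write \<open>\<phi>(t) = \<bar>t\<bar>^(p-2) t\<close> and \<open>q = n + \<sigma>p\<close>, and let \<open>G_i(R)\<close> be the part of the integral for
  \<open>u_i\<close> at \<open>x\<close> over the complement of \<open>B_R\<close>. The part over \<open>B_R\<close> converges to the one for \<open>v\<close>, by
  dominated convergence after symmetrization at the singularity; hence \<open>G_i(R)\<close> converges as
  \<open>i \<rightarrow> \<infinity>\<close> for every large \<open>R\<close>.  For \<open>a, b \<ge> 0\<close> one has
  \<open>\<bar>\<phi>(a - b) + b^(p-1)\<bar> \<le> \<epsilon> b^(p-1) + C_\<epsilon> a^(p-1)\<close>. With \<open>\<epsilon> = 1/2\<close> this bounds the tails \<open>T_i(1)\<close>
  uniformly in \<open>i\<close>; then, for small \<open>\<epsilon>\<close>, it shows that \<open>G_i(R) + T_i(R) \<rightarrow> 0\<close> as \<open>R \<rightarrow> \<infinity>\<close>, uniformly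
  in \<open>i\<close>. As \<open>T_i(R) - T_i(S)\<close> converges for fixed \<open>R < S\<close>, the sequence \<open>T_i(R)\<close> is Cauchy, and
  letting first \<open>i\<close> and then \<open>R\<close> tend to infinity gives the formula, with a constant that does not
  depend on \<open>x\<close> because \<open>T_i(R)\<close> does not.\<close>

section \<open>The signed power function\<close>

definition signed_powr :: "real \<Rightarrow> real \<Rightarrow> real" where
  "signed_powr p t = \<bar>t\<bar> powr (p - 2) * t"

lemma abs_signed_powr: "\<bar>signed_powr p t\<bar> = \<bar>t\<bar> powr (p - 1)"
proof (cases "t = 0")
  case False
  have "\<bar>t\<bar> powr (p - 1) = \<bar>t\<bar> powr (p - 2) * \<bar>t\<bar> powr 1"
    by (subst powr_add [symmetric]) simp
  then show ?thesis using False by (simp add: signed_powr_def abs_mult)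
qed (simp add: signed_powr_def)

lemma signed_powr_minus: "signed_powr p (- t) = - signed_powr p t"
  by (simp add: signed_powr_def)

lemma signed_powr_nonneg: "0 \<le> t \<Longrightarrow> signed_powr p t = t powr (p - 1)"
  using abs_signed_powr [of p t] by (simp add: signed_powr_def)

text \<open>The assumption \<open>p > 2\<close> makes the exponent \<open>p - 2\<close> positive, so
  that the power is continuous also at the zeros of \<open>f\<close>.\<close>

lemma continuous_on_signed_powr:
  assumes "p > 2" "continuous_on A f"
  shows "continuous_on A (\<lambda>x. signed_powr p (f x))"
  unfolding signed_powr_def
  by (intro continuous_intros continuous_on_powr' assms) (use assms in auto)

lemma tendsto_signed_powr:
  assumes "p > 2" "(f \<longlongrightarrow> a) F"
  shows "((\<lambda>x. signed_powr p (f x)) \<longlongrightarrow> signed_powr p a) F"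
proof -
  have "isCont (signed_powr p) a"
    using continuous_on_signed_powr [OF assms(1), of UNIV "\<lambda>x. x"]
    by (simp add: continuous_on_eq_continuous_at)
  then show ?thesis using assms(2) isCont_tendsto_compose by blast
qed

text \<open>Mean value theorem: the derivative \<open>r * z powr (r - 1)\<close> increases with z
  and so is at most its value at \<open>a\<close>. Differentiability is used only inside the
  interval, which allows \<open>b = 0\<close>.\<close>

lemma powr_diff_le:
  fixes a b r :: real
  assumes "r > 1" "0 \<le> b" "b < a"
  shows "a powr r - b powr r \<le> r * (a powr (r - 1)) * (a - b)"
proof -
  have "\<exists>l z. b < z \<and> z < a \<and> DERIV (\<lambda>t. t powr r) z :> l \<and> a powr r - b powr r = (a - b) * l"
  proof (rule MVT)
    show "continuous_on {b..a} (\<lambda>t. t powr r)"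
      by (intro continuous_on_powr' continuous_intros) (use assms in auto)
    fix z assume "b < z" "z < a"
    then show "(\<lambda>t. t powr r) differentiable (at z)"
      using assms has_real_derivative_powr [of z r] by (force simp: real_differentiable_def)
  qed fact
  then obtain l z where z: "b < z" "z < a" "DERIV (\<lambda>t. t powr r) z :> l"
      "a powr r - b powr r = (a - b) * l" by blast
  then have "l = r * z powr (r - 1)"
    using DERIV_unique has_real_derivative_powr [of z r] assms by force
  moreover have "z powr (r - 1) \<le> a powr (r - 1)"
    using z assms by (intro powr_mono2) auto
  ultimately show ?thesis using z assms by (simp add: mult_left_mono mult.commute)
qed

lemma signed_powr_diff_le_nonneg:
  assumes "p > 2" "0 \<le> b" "b \<le> a"
  shows "\<bar>signed_powr p a - signed_powr p b\<bar> \<le> (p - 1) * (a + b) powr (p - 2) * (a - b)"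
proof (cases "b = a")
  case False
  have "\<bar>signed_powr p a - signed_powr p b\<bar> = a powr (p - 1) - b powr (p - 1)"
    using assms by (simp add: signed_powr_nonneg powr_mono2)
  also have "\<dots> \<le> (p - 1) * a powr (p - 2) * (a - b)"
    using powr_diff_le [of "p - 1" b a] assms False by simp
  also have "\<dots> \<le> (p - 1) * (a + b) powr (p - 2) * (a - b)"
    using assms by (intro mult_mono powr_mono2) auto
  finally show ?thesis .
qed auto

text \<open>For a and b of the same sign, oddness and symmetry reduce to 0 \<le> b \<le> a. For
  opposite signs |a - b| = |a| + |b|, and the two values can be estimated separately because 1 \<le>
  p - 1.\<close>

lemma signed_powr_diff_le:
  assumes "p > 2"
  shows "\<bar>signed_powr p a - signed_powr p b\<bar> \<le> (p - 1) * (\<bar>a\<bar> + \<bar>b\<bar>) powr (p - 2) * \<bar>a - b\<bar>"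
proof -
  have mixed: "\<bar>signed_powr p a - signed_powr p b\<bar> \<le> (p - 1) * (\<bar>a\<bar> + \<bar>b\<bar>) powr (p - 2) * \<bar>a - b\<bar>"
    if "\<bar>a - b\<bar> = \<bar>a\<bar> + \<bar>b\<bar>" for a b
  proof -
    have "\<bar>signed_powr p a - signed_powr p b\<bar> \<le> \<bar>signed_powr p a\<bar> + \<bar>signed_powr p b\<bar>" by simp
    also have "\<dots> = \<bar>a\<bar> powr (p - 2) * \<bar>a\<bar> + \<bar>b\<bar> powr (p - 2) * \<bar>b\<bar>"
      by (simp add: signed_powr_def abs_mult)
    also have "\<dots> \<le> (\<bar>a\<bar> + \<bar>b\<bar>) powr (p - 2) * \<bar>a\<bar> + (\<bar>a\<bar> + \<bar>b\<bar>) powr (p - 2) * \<bar>b\<bar>"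
      using assms by (intro add_mono mult_right_mono powr_mono2) auto
    also have "\<dots> = 1 * ((\<bar>a\<bar> + \<bar>b\<bar>) powr (p - 2) * \<bar>a - b\<bar>)"
      using that by (simp add: algebra_simps)
    also have "\<dots> \<le> (p - 1) * ((\<bar>a\<bar> + \<bar>b\<bar>) powr (p - 2) * \<bar>a - b\<bar>)"
      using assms by (intro mult_right_mono) auto
    finally show ?thesis by (simp add: mult.assoc)
  qed
  consider "0 \<le> b" "b \<le> a" | "0 \<le> a" "a \<le> b" | "b \<le> 0" "a \<le> b" | "a \<le> 0" "b \<le> a"
    | "\<bar>a - b\<bar> = \<bar>a\<bar> + \<bar>b\<bar>" by linarith
  then show ?thesis
  proof cases
    case 1
    then show ?thesis using signed_powr_diff_le_nonneg [OF assms, of b a] by simp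
  next
    case 2
    then show ?thesis using signed_powr_diff_le_nonneg [OF assms, of a b]
      by (simp add: abs_minus_commute add.commute)
  next
    case 3
    then show ?thesis using signed_powr_diff_le_nonneg [OF assms, of "- b" "- a"]
      by (simp add: signed_powr_minus abs_minus_commute add.commute)
  next
    case 4
    then show ?thesis using signed_powr_diff_le_nonneg [OF assms, of "- a" "- b"]
      by (simp add: signed_powr_minus abs_minus_commute add.commute)
  next
    case 5
    then show ?thesis by (rule mixed)
  qed
qed

text \<open>As \<open>b powr (p - 1)\<close> equals \<open>- signed_powr p (- b)\<close>, the left
  side is a difference of two values of \<open>signed_powr\<close>. The bound for such differences
  gives a multiple of \<open>(a + 2 * b) powr (p - 2) * a\<close>, which is small against
  \<open>b powr (p - 1)\<close> if a is small compared with b, and is otherwise controlled by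
  \<open>a powr (p - 1)\<close>.\<close>

lemma signed_powr_add_le_eps:
  assumes "p > 2" "e > 0"
  obtains C where "C \<ge> 0" "\<And>a b. 0 \<le> a \<Longrightarrow> 0 \<le> b \<Longrightarrow>
      \<bar>signed_powr p (a - b) + b powr (p - 1)\<bar> \<le> e * b powr (p - 1) + C * a powr (p - 1)"
proof
  \<comment> \<open>If a \<le> d b, then d \<le> 1 gives a + 2 b \<le> 3 b, so the bound is at most
    (p - 1) 3^(p-2) d times \<open>b powr (p - 1)\<close>; this fixes \<open>d\<close>. If a > d b,
    then b \<le> a / d, which fixes \<open>C\<close>.\<close>
  define d where "d = min 1 (e / ((p - 1) * 3 powr (p - 2)))"
  define C where "C = (p - 1) * (1 + 2 / d) powr (p - 2)"
  have d: "0 < d" "d \<le> 1" "(p - 1) * 3 powr (p - 2) * d \<le> e"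
  proof -
    have *: "(p - 1) * 3 powr (p - 2) > 0" using assms by simp
    then show "0 < d" using assms unfolding d_def by auto
    show "d \<le> 1" unfolding d_def by auto
    have "d \<le> e / ((p - 1) * 3 powr (p - 2))" unfolding d_def by auto
    then show "(p - 1) * 3 powr (p - 2) * d \<le> e" using * by (simp add: field_simps)
  qed
  show "C \<ge> 0" using assms by (simp add: C_def)
  fix a b :: real assume ab: "0 \<le> a" "0 \<le> b"
  have pw: "t powr (p - 2) * t = t powr (p - 1)" if "0 \<le> t" for t
    using signed_powr_nonneg [OF that, of p] that by (simp add: signed_powr_def)
  have "\<bar>signed_powr p (a - b) + b powr (p - 1)\<bar> = \<bar>signed_powr p (a - b) - signed_powr p (- b)\<bar>"
    using ab by (simp add: signed_powr_minus signed_powr_nonneg)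
  also have "\<dots> \<le> (p - 1) * (\<bar>a - b\<bar> + \<bar>- b\<bar>) powr (p - 2) * \<bar>a - b - - b\<bar>"
    by (rule signed_powr_diff_le [OF assms(1)])
  also have "\<dots> \<le> (p - 1) * (a + 2 * b) powr (p - 2) * a"
    using ab assms by (intro mult_mono powr_mono2) auto
  also have "\<dots> \<le> e * b powr (p - 1) + C * a powr (p - 1)"
  proof (cases "a \<le> d * b")
    case True
    then have "a \<le> b" using d ab by (meson mult_left_le_one_le order.trans less_imp_le)
    then have "(p - 1) * (a + 2 * b) powr (p - 2) * a \<le> (p - 1) * (3 * b) powr (p - 2) * (d * b)"
      using ab assms True by (intro mult_mono powr_mono2) auto
    also have "\<dots> = ((p - 1) * 3 powr (p - 2) * d) * b powr (p - 1)"
      using ab by (simp add: powr_mult pw [symmetric])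
    also have "\<dots> \<le> e * b powr (p - 1)"
      using d by (intro mult_right_mono) auto
    finally show ?thesis using \<open>C \<ge> 0\<close> ab by (simp add: add_increasing2)
  next
    case False
    then have "b \<le> a / d" using d by (simp add: field_simps)
    then have "a + 2 * b \<le> a + 2 * (a / d)" by simp
    then have "a + 2 * b \<le> (1 + 2 / d) * a" by (simp add: algebra_simps)
    then have "(p - 1) * (a + 2 * b) powr (p - 2) * a \<le> (p - 1) * ((1 + 2 / d) * a) powr (p - 2) * a"
      using ab assms by (intro mult_mono powr_mono2) auto
    also have "\<dots> = C * a powr (p - 1)"
      using ab d by (simp add: powr_mult pw [symmetric] C_def)
    finally show ?thesis using assms ab by (simp add: add_increasing)
  qed
  finally show "\<bar>signed_powr p (a - b) + b powr (p - 1)\<bar> \<le> e * b powr (p - 1) + C * a powr (p - 1)" .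
qed

text \<open>Follows from |a - b| \<le> 2 max(|a|, |b|). It separates the value at the centre from
  the value at the integration variable, for integrability and for majorants.\<close>

lemma abs_signed_powr_diff_le:
  assumes "p > 2"
  shows "\<bar>signed_powr p (a - b)\<bar> \<le> 2 powr (p - 1) * (\<bar>a\<bar> powr (p - 1) + \<bar>b\<bar> powr (p - 1))"
proof -
  have "\<bar>a - b\<bar> powr (p - 1) \<le> (2 * max \<bar>a\<bar> \<bar>b\<bar>) powr (p - 1)"
    using assms by (intro powr_mono2) auto
  also have "\<dots> = 2 powr (p - 1) * max \<bar>a\<bar> \<bar>b\<bar> powr (p - 1)" by (simp add: powr_mult)
  also have "\<dots> \<le> 2 powr (p - 1) * (\<bar>a\<bar> powr (p - 1) + \<bar>b\<bar> powr (p - 1))"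
    by (auto simp: max_def)
  finally show ?thesis by (simp add: abs_signed_powr)
qed

section \<open>Integrability of powers of the norm\<close>

lemma nn_integral_ball:
  "r \<ge> 0 \<Longrightarrow> (\<integral>\<^sup>+ y. ennreal c * indicator (ball (0::'a::euclidean_space) r) y \<partial>lborel)
     = ennreal c * ennreal (unit_ball_vol DIM('a) * r ^ DIM('a))"
  by (subst nn_integral_cmult_indicator) (simp_all add: emeasure_ball)

text \<open>Comparison with a countable step function: |f| is at most the sum of the functions
  \<open>c k\<close> times the indicator of the ball of radius \<open>r k\<close>, and the integral
  of this sum is the volume of the unit ball times the given convergent series.\<close>

lemma integrable_dyadic_bound:
  fixes f :: "'a::euclidean_space \<Rightarrow> real" and c r :: "nat \<Rightarrow> real"
  assumes "f \<in> borel_measurable lborel" "\<And>k. 0 \<le> c k" "\<And>k. 0 \<le> r k"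
    and "summable (\<lambda>k. c k * r k ^ DIM('a))"
    and "\<And>y. f y \<noteq> 0 \<Longrightarrow> \<exists>k. norm y < r k \<and> \<bar>f y\<bar> \<le> c k"
  shows "integrable lborel f"
proof (rule integrableI_bounded)
  have "(\<integral>\<^sup>+ y. ennreal (norm (f y)) \<partial>lborel)
      \<le> (\<integral>\<^sup>+ y. (\<Sum>k. ennreal (c k) * indicator (ball (0::'a) (r k)) y) \<partial>lborel)"
  proof (rule nn_integral_mono)
    fix y
    show "ennreal (norm (f y)) \<le> (\<Sum>k. ennreal (c k) * indicator (ball 0 (r k)) y)"
    proof (cases "f y = 0")
      case False
      then obtain k where k: "norm y < r k" "\<bar>f y\<bar> \<le> c k" using assms(5) by blast
      have "ennreal (norm (f y)) \<le> (\<Sum>j\<in>{k}. ennreal (c j) * indicator (ball 0 (r j)) y)"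
        using k by (simp add: ennreal_leI)
      also have "\<dots> \<le> (\<Sum>j. ennreal (c j) * indicator (ball 0 (r j)) y)"
        by (rule sum_le_suminf) auto
      finally show ?thesis .
    qed simp
  qed
  also have "\<dots> = (\<Sum>k. \<integral>\<^sup>+ y. ennreal (c k) * indicator (ball (0::'a) (r k)) y \<partial>lborel)"
    by (rule nn_integral_suminf) (intro borel_measurable_times_ennreal borel_measurable_indicator; simp)
  also have "\<dots> = (\<Sum>k. ennreal (unit_ball_vol DIM('a) * (c k * r k ^ DIM('a))))"
    using assms(2,3) by (simp add: nn_integral_ball ennreal_mult' [symmetric] mult_ac)
  also have "\<dots> < \<infinity>"
    using assms(2,3) by (subst suminf_ennreal2)
       (auto intro!: mult_nonneg_nonneg summable_mult assms(4))
  finally show "(\<integral>\<^sup>+ y. ennreal (norm (f y)) \<partial>lborel) < \<infinity>" .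
qed (use assms(1) in simp)

text \<open>Dyadic balls of radius 2^k with heights 2^(-q(k-1)) lead to a geometric series of ratio
  2^(n-q) < 1.\<close>

lemma integrable_tail_weight:
  fixes q :: real
  assumes "q > DIM('a)"
  shows "integrable lborel (\<lambda>y::'a::euclidean_space. 1 / (1 + norm y powr q))"
proof (rule integrable_dyadic_bound)
  let ?n = "DIM('a)"
  show "(\<lambda>y::'a. 1 / (1 + norm y powr q)) \<in> borel_measurable lborel" by measurable
  have eq: "(2::real) powr (- q * (real k - 1)) * (2 ^ k) ^ ?n = 2 powr q * (2 powr (real ?n - q)) ^ k" for k :: nat
    by (simp add: powr_realpow [symmetric] powr_powr powr_add [symmetric] algebra_simps powr_power)
  show "summable (\<lambda>k. (2::real) powr (- q * (real k - 1)) * (2 ^ k) ^ ?n)"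
    unfolding eq
    by (intro summable_mult summable_geometric) (use assms in \<open>simp add: powr_less_one\<close>)
  fix y :: 'a
  show "\<exists>k. norm y < 2 ^ k \<and> \<bar>1 / (1 + norm y powr q)\<bar> \<le> 2 powr (- q * (real k - 1))"
  proof (cases "norm y < 1")
    case True
    have "0 \<le> norm y powr q" by simp
    then have "\<bar>1 / (1 + norm y powr q)\<bar> \<le> 1"
      by (smt (verit) divide_le_eq_1 divide_nonneg_nonneg)
    also have "1 \<le> (2::real) powr q" using assms by (intro ge_one_powr_ge_zero) auto
    finally show ?thesis using True by (intro exI [of _ 0]) auto
  next
    case False
    have "\<exists>k. norm y < 2 ^ k" by (rule real_arch_pow) simp
    \<comment> \<open>The least such \<open>k\<close> also satisfies 2^(k-1) \<le> |y|, which
      explains the shift by one in the heights.\<close>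
    then obtain k where k: "norm y < 2 ^ k" "\<And>j. j < k \<Longrightarrow> \<not> norm y < 2 ^ j"
      using exists_least_iff [of "\<lambda>k. norm y < 2 ^ k"] by blast
    have "k \<noteq> 0" using k(1) False by (cases k) auto
    then have "2 ^ (k - 1) \<le> norm y" using k(2) [of "k - 1"] by auto
    then have "2 powr (real k - 1) \<le> norm y" using \<open>k \<noteq> 0\<close> by (simp add: powr_realpow [symmetric] of_nat_diff)
    then have "2 powr ((real k - 1) * q) \<le> norm y powr q"
      using assms by (subst powr_powr [symmetric], intro powr_mono2) auto
    moreover have "(2::real) powr ((real k - 1) * q) > 0" by simp
    ultimately have "1 / (1 + norm y powr q) \<le> 1 / 2 powr ((real k - 1) * q)"
      by (intro divide_left_mono mult_pos_pos) linarith+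
    also have "\<dots> = 2 powr (- q * (real k - 1))" by (simp add: powr_minus_divide [symmetric] mult_ac)
    finally show ?thesis using k(1) by (auto simp: add_nonneg_nonneg)
  qed
qed auto

text \<open>Dyadic balls of radius 2^(-k) shrinking to the origin, with heights 2^(b(k+1)), lead to
  a geometric series of ratio 2^(b-n) < 1.\<close>

lemma integrable_norm_powr_ball:
  fixes a :: real
  assumes "a < DIM('a)"
  shows "integrable lborel (\<lambda>y::'a::euclidean_space. indicator (ball 0 1) y * norm y powr (- a))"
proof (rule integrable_dyadic_bound)
  let ?n = "DIM('a)"
  \<comment> \<open>A nonnegative exponent makes the powers monotone on each annulus; it is still
    below the dimension, and on the unit ball it only enlarges the function.\<close>
  define b where "b = max a 0"
  have b: "0 \<le> b" "a \<le> b" "b < ?n" using assms by (auto simp: b_def)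
  show "(\<lambda>y::'a. indicator (ball 0 1) y * norm y powr (- a)) \<in> borel_measurable lborel"
    by (intro borel_measurable_times borel_measurable_indicator) (simp, measurable)
  have eq: "(2::real) powr (b * (real k + 1)) * (1 / 2 ^ k) ^ ?n = 2 powr b * (2 powr (b - real ?n)) ^ k" for k :: nat
  proof -
    have "(1 / 2 ^ k) ^ ?n = (2::real) powr (- (real k * real ?n))"
      by (simp add: powr_realpow [symmetric] powr_powr powr_minus_divide power_one_over powr_power)
    then show ?thesis by (simp add: powr_power powr_add [symmetric] algebra_simps)
  qed
  show "summable (\<lambda>k. (2::real) powr (b * (real k + 1)) * (1 / 2 ^ k) ^ ?n)"
    unfolding eq
    by (intro summable_mult summable_geometric) (use b in \<open>simp add: powr_less_one\<close>)
  fix y :: 'a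
  assume "indicator (ball 0 1) y * norm y powr (- a) \<noteq> 0"
  then have y: "norm y < 1" "y \<noteq> 0" by (auto simp: indicator_def split: if_splits)
  have "\<exists>k. 1 / norm y < 2 ^ k" by (rule real_arch_pow) simp
  then have "\<exists>k. 1 / 2 ^ k \<le> norm y" using y by (auto simp: field_simps intro: less_imp_le)
  \<comment> \<open>As |y| < 1, the least \<open>k\<close> is positive. Its predecessor
    \<open>j\<close> gives 2^(-(j+1)) \<le> |y| < 2^(-j), so the ball of index \<open>j\<close> is
    the one to use.\<close>
  then obtain k where k: "1 / 2 ^ k \<le> norm y" "\<And>j. j < k \<Longrightarrow> \<not> 1 / 2 ^ j \<le> norm y"
    using exists_least_iff [of "\<lambda>k. 1 / 2 ^ k \<le> norm y"] by blast
  then obtain j where j: "k = Suc j" using y by (cases k) auto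
  have "(1 / 2 ^ k) powr b \<le> norm y powr b" using k(1) b by (intro powr_mono2) auto
  then have "norm y powr (- b) \<le> (2 ^ k) powr b"
    using y by (simp add: powr_minus powr_divide field_simps)
  moreover have "norm y powr (- a) \<le> norm y powr (- b)" using y b by (intro powr_mono') auto
  moreover have "(2 ^ k) powr b = (2::real) powr (b * (real j + 1))"
    by (simp add: powr_realpow [symmetric] powr_powr j mult_ac add_ac del: power_Suc)
  ultimately have "norm y powr (- a) \<le> 2 powr (b * (real j + 1))" by simp
  then show "\<exists>k. norm y < 1 / 2 ^ k \<and> \<bar>indicator (ball 0 1) y * norm y powr - a\<bar> \<le> 2 powr (b * (real k + 1))"
    using k(2) [of j] j by (intro exI [of _ j]) (auto simp: indicator_def)
qed auto

section \<open>Local Hoelder bounds on differences\<close>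

lemma frechet_derivative_eq_sum_partial_deriv:
  fixes f :: "'a::euclidean_space \<Rightarrow> real"
  assumes "f differentiable (at x)"
  shows "frechet_derivative f (at x) h = (\<Sum>b\<in>Basis. (h \<bullet> b) * partial_deriv b f x)"
proof -
  have lin: "linear (frechet_derivative f (at x))"
    by (rule linear_frechet_derivative [OF assms])
  have "frechet_derivative f (at x) h = frechet_derivative f (at x) (\<Sum>b\<in>Basis. (h \<bullet> b) *\<^sub>R b)"
    by (simp add: euclidean_representation)
  also have "\<dots> = (\<Sum>b\<in>Basis. (h \<bullet> b) * partial_deriv b f x)"
    by (simp add: linear_sum [OF lin] linear_cmul [OF lin] partial_deriv_def)
  finally show ?thesis .
qed

lemma partial_deriv_diff:
  assumes "f differentiable_on UNIV" "g differentiable_on UNIV"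
  shows "partial_deriv b (\<lambda>x. f x - g x) = (\<lambda>x. partial_deriv b f x - partial_deriv b g x)"
proof
  fix x
  have "(f has_derivative frechet_derivative f (at x)) (at x)"
    "(g has_derivative frechet_derivative g (at x)) (at x)"
    using assms by (auto simp: differentiable_on_def frechet_derivative_works)
  then have "((\<lambda>x. f x - g x) has_derivative
      (\<lambda>h. frechet_derivative f (at x) h - frechet_derivative g (at x) h)) (at x)"
    by (rule has_derivative_diff)
  then have "frechet_derivative (\<lambda>x. f x - g x) (at x)
      = (\<lambda>h. frechet_derivative f (at x) h - frechet_derivative g (at x) h)"
    by (rule frechet_derivative_at [symmetric])
  then show "partial_deriv b (\<lambda>x. f x - g x) x = partial_deriv b f x - partial_deriv b g x"
    by (simp add: partial_deriv_def)
qed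

lemma Ck_diff:
  "Ck k f \<Longrightarrow> Ck k g \<Longrightarrow> Ck k (\<lambda>x. f x - g x)"
  by (induction k arbitrary: f g)
     (auto intro: continuous_on_diff differentiable_on_diff simp: partial_deriv_diff)

lemma Ck_imp_continuous_on:
  "Ck k f \<Longrightarrow> continuous_on UNIV f"
  by (cases k) (auto intro: differentiable_imp_continuous_on)

text \<open>The Hoelder norm is a finite sum of nonnegative terms in \<open>ennreal\<close>, so a
  bound for it bounds every summand, hence every value and every difference quotient.\<close>

lemma
  fixes f :: "'a::euclidean_space \<Rightarrow> real"
  assumes M: "holder_norm k g K f \<le> ennreal M" "0 \<le> M" and bs: "set bs \<subseteq> Basis"
  shows holder_norm_imp_iter_partial_le:
      "length bs \<le> k \<Longrightarrow> x \<in> K \<Longrightarrow> \<bar>iter_partial bs f x\<bar> \<le> M"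
    and holder_norm_imp_holder_continuous:
      "length bs = k \<Longrightarrow> x \<in> K \<Longrightarrow> y \<in> K \<Longrightarrow>
        \<bar>iter_partial bs f x - iter_partial bs f y\<bar> \<le> M * norm (x - y) powr g"
proof -
  define S where "S = (\<Sum>bs | set bs \<subseteq> (Basis :: 'a set) \<and> length bs \<le> k.
    SUP x\<in>K. ennreal \<bar>iter_partial bs f x\<bar>)"
  define H where "H = (\<Sum>bs | set bs \<subseteq> (Basis :: 'a set) \<and> length bs = k.
    holder_seminorm g K (iter_partial bs f))"
  have "S + H \<le> ennreal M" using M by (simp add: holder_norm_def S_def H_def)
  then have SH: "S \<le> ennreal M" "H \<le> ennreal M"
    by (meson add_increasing2 add_increasing order.trans order_refl zero_le)+
  show "\<bar>iter_partial bs f x\<bar> \<le> M" if "length bs \<le> k" "x \<in> K"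
  proof -
    have "ennreal \<bar>iter_partial bs f x\<bar> \<le> (SUP x\<in>K. ennreal \<bar>iter_partial bs f x\<bar>)"
      using that by (intro SUP_upper)
    also have "\<dots> \<le> S" unfolding S_def
      using that bs by (intro member_le_sum) (auto intro: finite_lists_length_le)
    finally show ?thesis using SH M by (meson ennreal_le_iff order.trans)
  qed
  show "\<bar>iter_partial bs f x - iter_partial bs f y\<bar> \<le> M * norm (x - y) powr g"
    if "length bs = k" "x \<in> K" "y \<in> K"
  proof (cases "x = y")
    case False
    have "ennreal (\<bar>iter_partial bs f x - iter_partial bs f y\<bar> / norm (x - y) powr g)
        \<le> holder_seminorm g K (iter_partial bs f)"
      unfolding holder_seminorm_def using that False by (intro SUP_upper2 [of "(x, y)"]) auto
    also have "\<dots> \<le> H" unfolding H_def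
      using that bs by (intro member_le_sum) (auto intro: finite_lists_length_eq)
    finally have "\<bar>iter_partial bs f x - iter_partial bs f y\<bar> / norm (x - y) powr g \<le> M"
      using SH M by (meson ennreal_le_iff order.trans)
    then show ?thesis using False by (simp add: field_simps)
  qed (use M in simp)
qed

text \<open>Estimating coordinate by coordinate, the operator norm of the derivative is at most n M;
  then the mean value inequality applies on the convex set.\<close>

lemma lipschitz_of_partial_deriv_le:
  fixes f :: "'a::euclidean_space \<Rightarrow> real"
  assumes "convex K" "f differentiable_on UNIV" "x \<in> K" "y \<in> K"
    and "\<And>b z. b \<in> Basis \<Longrightarrow> z \<in> K \<Longrightarrow> \<bar>partial_deriv b f z\<bar> \<le> M"
  shows "\<bar>f x - f y\<bar> \<le> real DIM('a) * M * norm (x - y)"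
proof -
  have diff: "f differentiable (at z)" for z using assms(2) by (simp add: differentiable_on_def)
  have "norm (f x - f y) \<le> real DIM('a) * M * norm (x - y)"
  proof (rule differentiable_bound [OF assms(1) _ _ assms(3,4)])
    fix z assume z: "z \<in> K"
    show "(f has_derivative frechet_derivative f (at z)) (at z within K)"
      using diff by (meson frechet_derivative_works has_derivative_at_withinI)
    show "onorm (frechet_derivative f (at z)) \<le> real DIM('a) * M"
    proof (rule onorm_le)
      fix h
      have "\<bar>\<Sum>b\<in>Basis. (h \<bullet> b) * partial_deriv b f z\<bar> \<le> (\<Sum>b\<in>(Basis::'a set). norm h * M)"
        using z assms(5) Basis_le_norm
        by (intro sum_abs [THEN order.trans] sum_mono) (auto simp: abs_mult intro!: mult_mono)
      then show "norm (frechet_derivative f (at z) h) \<le> real DIM('a) * M * norm h"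
        by (simp add: frechet_derivative_eq_sum_partial_deriv [OF diff] mult_ac)
    qed
  qed
  then show ?thesis by simp
qed

text \<open>The mean value theorem for t \<mapsto> f(x + t h) + f(x - t h) on [0, 1] yields the
  difference of the derivatives at x + t h and x - t h, applied to h. These points have distance at
  most 2 |h|, whence the factor 2^d and the order 1 + d.\<close>

lemma second_difference_le:
  fixes f :: "'a::euclidean_space \<Rightarrow> real"
  assumes "f differentiable_on UNIV" "norm h \<le> 1" "0 \<le> d" "0 \<le> L"
    and "\<And>b y z. b \<in> Basis \<Longrightarrow> y \<in> cball x 1 \<Longrightarrow> z \<in> cball x 1 \<Longrightarrow>
           \<bar>partial_deriv b f y - partial_deriv b f z\<bar> \<le> L * norm (y - z) powr d"
  shows "\<bar>f (x + h) + f (x - h) - 2 * f x\<bar> \<le> real DIM('a) * L * 2 powr d * norm h powr (1 + d)"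
proof -
  have diff: "f differentiable (at z)" for z using assms(1) by (simp add: differentiable_on_def)
  define D where "D = (\<lambda>z. frechet_derivative f (at z))"
  have D: "(f has_derivative D z) (at z)" for z
    using diff by (simp add: D_def frechet_derivative_works [symmetric])
  have lin: "linear (D z)" for z using D has_derivative_linear by blast
  have der: "((\<lambda>t. f (x + t *\<^sub>R w)) has_real_derivative D (x + t *\<^sub>R w) w) (at t)" for t w
  proof -
    have "((\<lambda>t. f (x + t *\<^sub>R w)) has_derivative (\<lambda>s. D (x + t *\<^sub>R w) (s *\<^sub>R w))) (at t)"
      by (rule has_derivative_compose [OF _ D]) (auto intro!: derivative_eq_intros)
    then show ?thesis
      by (simp add: has_field_derivative_def linear_cmul [OF lin] mult_commute_abs)
  qed
  have "\<exists>t. 0 < t \<and> t < 1 \<and> (f (x + 1 *\<^sub>R h) + f (x + 1 *\<^sub>R (- h))) - (f (x + 0 *\<^sub>R h) + f (x + 0 *\<^sub>R (- h)))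
      = (1 - 0) * (D (x + t *\<^sub>R h) h + D (x + t *\<^sub>R (- h)) (- h))"
    by (rule MVT2) (auto intro!: DERIV_add der simp del: scaleR_minus_right)
  then obtain t where t: "0 < t" "t < 1" "f (x + h) + f (x - h) - 2 * f x
      = D (x + t *\<^sub>R h) h + D (x + t *\<^sub>R (- h)) (- h)" by auto
  have "D (x + t *\<^sub>R h) h + D (x + t *\<^sub>R (- h)) (- h) = D (x + t *\<^sub>R h) h - D (x - t *\<^sub>R h) h"
    by (simp add: linear_neg [OF lin])
  also have "\<dots> = (\<Sum>b\<in>Basis. (h \<bullet> b) * (partial_deriv b f (x + t *\<^sub>R h) - partial_deriv b f (x - t *\<^sub>R h)))"
    by (simp add: D_def frechet_derivative_eq_sum_partial_deriv [OF diff] sum_subtractf right_diff_distrib)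
  also have "\<bar>\<dots>\<bar> \<le> (\<Sum>b\<in>(Basis::'a set). norm h * (L * (2 * norm h) powr d))"
  proof (intro sum_abs [THEN order.trans] sum_mono)
    fix b :: 'a assume b: "b \<in> Basis"
    have th: "t * norm h \<le> norm h" "t * norm h \<le> 1" using t assms(2) by (auto intro: mult_left_le_one_le mult_le_one)
    have "\<bar>partial_deriv b f (x + t *\<^sub>R h) - partial_deriv b f (x - t *\<^sub>R h)\<bar>
        \<le> L * norm ((x + t *\<^sub>R h) - (x - t *\<^sub>R h)) powr d"
      using b t th by (intro assms(5)) (auto simp: dist_norm)
    also have "(x + t *\<^sub>R h) - (x - t *\<^sub>R h) = (2 * t) *\<^sub>R h" by (simp add: algebra_simps scaleR_2 flip: scaleR_scaleR)
    also have "L * norm ((2 * t) *\<^sub>R h) powr d \<le> L * (2 * norm h) powr d"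
      using t th assms by (intro mult_left_mono powr_mono2) auto
    finally show "\<bar>h \<bullet> b * (partial_deriv b f (x + t *\<^sub>R h) - partial_deriv b f (x - t *\<^sub>R h))\<bar>
        \<le> norm h * (L * (2 * norm h) powr d)"
      using b Basis_le_norm [of b h] by (auto simp: abs_mult intro!: mult_mono)
  qed
  also have "\<dots> = real DIM('a) * L * 2 powr d * norm h powr (1 + d)"
    by (cases "h = 0") (simp_all add: powr_mult powr_add mult_ac)
  finally show ?thesis using t(3) by simp
qed

text \<open>Besides continuity, this is the local regularity on which the principal value rests.
  Functions of class \<open>C_loc s\<close> satisfy it with the orders \<open>min s 1\<close> and
  \<open>min s 2\<close>.\<close>

definition diffs_bounded ::
    "real \<Rightarrow> real \<Rightarrow> real \<Rightarrow> ('a::euclidean_space \<Rightarrow> real) \<Rightarrow> 'a \<Rightarrow> bool" where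
  "diffs_bounded r s C f x \<longleftrightarrow> (\<forall>h. norm h \<le> 1 \<longrightarrow>
     \<bar>f (x + h) - f x\<bar> \<le> C * norm h powr r \<and>
     \<bar>f (x + h) + f (x - h) - 2 * f x\<bar> \<le> C * norm h powr s)"

lemma diffs_bounded_add:
  assumes "diffs_bounded r s A f x" "diffs_bounded r s B g x"
  shows "diffs_bounded r s (A + B) (\<lambda>y. f y + g y) x"
  unfolding diffs_bounded_def
proof (intro allI impI)
  fix h :: 'a assume h: "norm h \<le> 1"
  have add: "\<bar>a + b\<bar> \<le> (A + B) * t" if "\<bar>a\<bar> \<le> A * t" "\<bar>b\<bar> \<le> B * t" for a b t
    using that by (simp add: distrib_right)
  show "\<bar>f (x + h) + g (x + h) - (f x + g x)\<bar> \<le> (A + B) * norm h powr r \<and>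
     \<bar>f (x + h) + g (x + h) + (f (x - h) + g (x - h)) - 2 * (f x + g x)\<bar> \<le> (A + B) * norm h powr s"
    using assms h add [of "f (x + h) - f x" "norm h powr r" "g (x + h) - g x"]
      add [of "f (x + h) + f (x - h) - 2 * f x" "norm h powr s" "g (x + h) + g (x - h) - 2 * g x"]
    by (simp add: diffs_bounded_def algebra_simps)
qed

text \<open>If [s] = 0, the Hoelder bound on f controls both differences, the second being a sum of
  two first ones. If [s] = 1, the gradient is bounded and Hoelder continuous with exponent s - 1. If
  [s] \<ge> 2, bounded second derivatives make the gradient Lipschitz. The constant dominates those
  of all three cases.\<close>

lemma diffs_bounded_of_holder_norm:
  fixes f :: "'a::euclidean_space \<Rightarrow> real"
  assumes s: "s > 0" and f: "Ck (nat \<lfloor>s\<rfloor>) f"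
    and M: "holder_norm (nat \<lfloor>s\<rfloor>) (s - of_int \<lfloor>s\<rfloor>) (cball x 1) f \<le> ennreal M" "0 \<le> M"
  shows "diffs_bounded (min s 1) (min s 2) (2 * (real DIM('a))\<^sup>2 * M) f x"
  unfolding diffs_bounded_def
proof (intro allI impI)
  fix h :: 'a assume h: "norm h \<le> 1"
  let ?n = "real DIM('a)" and ?k = "nat \<lfloor>s\<rfloor>" and ?g = "s - of_int \<lfloor>s\<rfloor>"
  have mem: "x \<in> cball x 1" "x + h \<in> cball x 1" "x - h \<in> cball x 1"
    using h by (auto simp: dist_norm)
  have n1: "1 \<le> ?n" by simp
  then have n2: "?n \<le> ?n\<^sup>2" by (simp add: power2_eq_square)
  note le = holder_norm_imp_iter_partial_le [OF M] and ho = holder_norm_imp_holder_continuous [OF M]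
  have first: "\<bar>f (x + h) - f x\<bar> \<le> ?n * M * norm h powr 1" if "?k \<ge> 1"
  proof -
    have "\<bar>f (x + h) - f x\<bar> \<le> ?n * M * norm ((x + h) - x)"
    proof (rule lipschitz_of_partial_deriv_le [of "cball x 1"])
      show "f differentiable_on UNIV" using f that by (cases ?k) auto
      fix b z :: 'a assume "b \<in> Basis" "z \<in> cball x 1"
      then show "\<bar>partial_deriv b f z\<bar> \<le> M" using le [of "[b]" z] that by (simp add: iter_partial_def)
    qed (use mem in auto)
    then show ?thesis by simp
  qed
  have nM: "?n * M \<le> 2 * ?n\<^sup>2 * M" using n1 n2 M by (intro mult_right_mono) linarith+
  consider "?k = 0" | "?k = 1" | "?k \<ge> 2" by linarith
  then show "\<bar>f (x + h) - f x\<bar> \<le> 2 * ?n\<^sup>2 * M * norm h powr (min s 1) \<and>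
     \<bar>f (x + h) + f (x - h) - 2 * f x\<bar> \<le> 2 * ?n\<^sup>2 * M * norm h powr (min s 2)"
  proof cases
    case 1
    then have s1: "s < 1" "?g = s" using s by linarith+
    have a: "\<bar>f (x + h) - f x\<bar> \<le> M * norm h powr s" "\<bar>f (x - h) - f x\<bar> \<le> M * norm h powr s"
      using ho [of "[]" "x + h" x] ho [of "[]" "x - h" x] mem 1 s1 by (simp_all add: iter_partial_def)
    have "M * 1 \<le> M * ?n\<^sup>2" using order.trans [OF n1 n2] M(2) by (rule mult_left_mono)
    then have "2 * M \<le> 2 * ?n\<^sup>2 * M" by (simp add: mult.commute)
    then have "2 * M * norm h powr s \<le> 2 * ?n\<^sup>2 * M * norm h powr s"
      by (rule mult_right_mono) simp
    moreover have "0 \<le> M * norm h powr s" using M by simp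
    ultimately show ?thesis using a s1 by (simp add: min_def; linarith)
  next
    case 2
    then have s1: "1 \<le> s" "s < 2" "?g = s - 1" by linarith+
    have "\<bar>f (x + h) + f (x - h) - 2 * f x\<bar> \<le> ?n * M * 2 powr (s - 1) * norm h powr (1 + (s - 1))"
    proof (rule second_difference_le)
      show "f differentiable_on UNIV" using f 2 by auto
      fix b y z :: 'a assume "b \<in> Basis" "y \<in> cball x 1" "z \<in> cball x 1"
      then show "\<bar>partial_deriv b f y - partial_deriv b f z\<bar> \<le> M * norm (y - z) powr (s - 1)"
        using ho [of "[b]" y z] 2 s1 by (simp add: iter_partial_def)
    qed (use h s1 M in auto)
    also have "\<dots> \<le> ?n\<^sup>2 * M * 2 powr 1 * norm h powr s"
      using s1 M n2 powr_mono [of "s - 1" 1 2] by (intro mult_mono) auto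
    finally show ?thesis using s1 first [THEN order.trans, OF _ mult_right_mono [OF nM]] 2 by (simp add: min_def mult_ac)
  next
    case 3
    then have s1: "2 \<le> s" by linarith
    obtain k where k: "?k = Suc (Suc k)" using 3 by (metis add_2_eq_Suc le_Suc_ex)
    have "\<bar>f (x + h) + f (x - h) - 2 * f x\<bar> \<le> ?n * (?n * M) * 2 powr 1 * norm h powr (1 + 1)"
    proof (rule second_difference_le)
      show "f differentiable_on UNIV" using f k by auto
      fix b y z :: 'a assume b: "b \<in> Basis" "y \<in> cball x 1" "z \<in> cball x 1"
      have "\<bar>partial_deriv b f y - partial_deriv b f z\<bar> \<le> ?n * M * norm (y - z)"
      proof (rule lipschitz_of_partial_deriv_le [of "cball x 1"])
        show "partial_deriv b f differentiable_on UNIV" using f k b by auto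
        \<comment> \<open>The list of \<open>iter_partial\<close> is processed from the left, so the
          mixed derivative taken first along \<open>b\<close> and then along \<open>c\<close> is
          encoded by \<open>[b, c]\<close>.\<close>
        fix c w :: 'a assume "c \<in> Basis" "w \<in> cball x 1"
        then show "\<bar>partial_deriv c (partial_deriv b f) w\<bar> \<le> M"
          using le [of "[b, c]" w] 3 b by (simp add: iter_partial_def)
      qed (use b in auto)
      then show "\<bar>partial_deriv b f y - partial_deriv b f z\<bar> \<le> ?n * M * norm (y - z) powr 1"
        by simp
    qed (use h M in auto)
    then show ?thesis using s1 first [THEN order.trans, OF _ mult_right_mono [OF nM]] 3
      by (simp add: min_def power2_eq_square mult_ac)
  qed
qed

text \<open>The empty list of derivatives contributes the supremum of |u_i - v| over K to the
  Hoelder norm.\<close>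

lemma uniform_limit_of_C_loc_tendsto:
  assumes "C_loc_tendsto s u v" "compact K"
  shows "uniform_limit K u v sequentially"
proof (rule uniform_limitI)
  fix e :: real assume "e > 0"
  let ?H = "\<lambda>i. holder_norm (nat \<lfloor>s\<rfloor>) (s - of_int \<lfloor>s\<rfloor>) K (\<lambda>x. u i x - v x)"
  have "?H \<longlonglongrightarrow> 0" using assms by (auto simp: C_loc_tendsto_def holder_loc_tendsto_def)
  then have "\<forall>\<^sub>F i in sequentially. ?H i < ennreal (e / 2)"
    using \<open>e > 0\<close> by (intro order_tendstoD) auto
  then show "\<forall>\<^sub>F i in sequentially. \<forall>x\<in>K. dist (u i x) (v x) < e"
  proof eventually_elim
    case (elim i)
    then have "\<bar>u i x - v x\<bar> \<le> e / 2" if "x \<in> K" for x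
      using holder_norm_imp_iter_partial_le [OF less_imp_le, of _ _ K "\<lambda>x. u i x - v x" "e / 2" "[]" x]
        \<open>e > 0\<close> that by (simp add: iter_partial_def)
    then show ?case using \<open>e > 0\<close> by (force simp: dist_real_def)
  qed
qed

lemma C_loc_imp_diffs_bounded:
  assumes "s > 0" "f \<in> C_loc s"
  shows "\<exists>C. diffs_bounded (min s 1) (min s 2) C f x"
proof -
  have "Ck (nat \<lfloor>s\<rfloor>) f" and "holder_norm (nat \<lfloor>s\<rfloor>) (s - of_int \<lfloor>s\<rfloor>) (cball x 1) f < \<infinity>"
    using assms(2) by (auto simp: C_loc_def holder_loc_def)
  then show ?thesis
    using diffs_bounded_of_holder_norm [OF assms(1), of f x]
    by (metis ennreal_cases infinity_ennreal_def less_irrefl order_refl)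
qed

text \<open>Write u_i = v + (u_i - v). For large i the Hoelder norm of the difference on the unit
  ball about x is below 1, so the constants of the two parts add up to one that does not depend on
  i.\<close>

lemma eventually_diffs_bounded_of_C_loc_tendsto:
  assumes "s > 0" "C_loc_tendsto s u v"
  shows "\<exists>C. \<forall>\<^sub>F i in sequentially. diffs_bounded (min s 1) (min s 2) C (u i) x"
proof -
  have v: "v \<in> C_loc s" and u: "u i \<in> C_loc s" for i
    using assms(2) by (auto simp: C_loc_tendsto_def holder_loc_tendsto_def C_loc_def)
  obtain C where C: "diffs_bounded (min s 1) (min s 2) C v x"
    using C_loc_imp_diffs_bounded [OF assms(1) v] by blast
  let ?H = "\<lambda>i. holder_norm (nat \<lfloor>s\<rfloor>) (s - of_int \<lfloor>s\<rfloor>) (cball x 1) (\<lambda>x. u i x - v x)"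
  have "?H \<longlonglongrightarrow> 0" using assms by (auto simp: C_loc_tendsto_def holder_loc_tendsto_def)
  then have "\<forall>\<^sub>F i in sequentially. ?H i < ennreal 1"
    by (intro order_tendstoD) auto
  then have "\<forall>\<^sub>F i in sequentially.
      diffs_bounded (min s 1) (min s 2) (C + 2 * (real DIM('a))\<^sup>2 * 1) (\<lambda>y. v y + (u i y - v y)) x"
  proof eventually_elim
    case (elim i)
    have "Ck (nat \<lfloor>s\<rfloor>) (\<lambda>y. u i y - v y)"
      using u [of i] v by (intro Ck_diff) (auto simp: C_loc_def holder_loc_def)
    then show ?case
      using elim by (intro diffs_bounded_add C diffs_bounded_of_holder_norm assms) auto
  qed
  then show ?thesis by auto
qed

section \<open>The principal value\<close>

text \<open>Finitely many indices may violate the domination, as the local bounds on u_i hold only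
  for large i; these indices are discarded by a shift.\<close>

lemma integral_eventually_dominated_convergence:
  fixes s :: "nat \<Rightarrow> 'a \<Rightarrow> real"
  assumes "f \<in> borel_measurable M" "\<And>i. s i \<in> borel_measurable M" "integrable M w"
    and lim: "\<And>x. (\<lambda>i. s i x) \<longlonglongrightarrow> f x"
    and bd: "\<forall>\<^sub>F i in sequentially. \<forall>x. \<bar>s i x\<bar> \<le> w x"
  shows "(\<lambda>i. integral\<^sup>L M (s i)) \<longlonglongrightarrow> integral\<^sup>L M f"
proof -
  obtain N where N: "\<And>i x. i \<ge> N \<Longrightarrow> \<bar>s i x\<bar> \<le> w x"
    using bd by (auto simp: eventually_sequentially)
  have "(\<lambda>i. integral\<^sup>L M (s (i + N))) \<longlonglongrightarrow> integral\<^sup>L M f"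
  proof (rule integral_dominated_convergence [where w = w])
    show "AE x in M. (\<lambda>i. s (i + N) x) \<longlonglongrightarrow> f x"
      using LIMSEQ_ignore_initial_segment [OF lim] by simp
  qed (use assms N in auto)
  then show ?thesis by (rule LIMSEQ_offset)
qed

lemma set_integral_bounded_convergence:
  fixes f :: "nat \<Rightarrow> 'a::euclidean_space \<Rightarrow> real"
  assumes A: "A \<in> sets borel" "A \<subseteq> ball 0 R"
    and [measurable]: "\<And>i. f i \<in> borel_measurable borel" "g \<in> borel_measurable borel"
    and lim: "\<And>y. y \<in> A \<Longrightarrow> (\<lambda>i. f i y) \<longlonglongrightarrow> g y"
    and bd: "\<forall>\<^sub>F i in sequentially. \<forall>y\<in>A. \<bar>f i y\<bar> \<le> B"
  shows "(\<lambda>i. LINT y:A|lborel. f i y) \<longlonglongrightarrow> (LINT y:A|lborel. g y)"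
  unfolding set_lebesgue_integral_def
proof (rule integral_eventually_dominated_convergence)
  have "emeasure lborel A \<le> emeasure lborel (ball (0::'a) R)"
    using A by (intro emeasure_mono) auto
  also have "\<dots> < \<infinity>" by (rule emeasure_lborel_ball_finite)
  finally have "integrable lborel (indicator A :: 'a \<Rightarrow> real)"
    using A by (intro integrable_real_indicator) auto
  then show "integrable lborel (\<lambda>y. indicator A y * B)" by simp
  show "\<forall>\<^sub>F i in sequentially. \<forall>y. \<bar>indicator A y *\<^sub>R f i y\<bar> \<le> indicator A y * B"
    using bd by eventually_elim (auto simp: indicator_def)
  show "(\<lambda>i. indicator A y *\<^sub>R f i y) \<longlonglongrightarrow> indicator A y *\<^sub>R g y" for y
    using lim by (cases "y \<in> A") auto
qed (use A in measurable)

lemma set_integral_outside_ball_tendsto_0: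
  fixes f :: "'a::euclidean_space \<Rightarrow> real"
  assumes "set_integrable lborel (- ball 0 r) f"
  shows "((\<lambda>R. LINT y:- ball 0 R|lborel. f y) \<longlongrightarrow> 0) at_top"
proof -
  let ?f = "\<lambda>y. indicator (- ball 0 r) y *\<^sub>R f y"
  have int: "integrable lborel ?f" using assms by (simp add: set_integrable_def)
  then have [measurable]: "?f \<in> borel_measurable lborel" by simp
  have [measurable]: "- ball (0::'a) R \<in> sets borel" for R by simp
  have "((\<lambda>R. \<integral>y. indicator (- ball 0 R) y * ?f y \<partial>lborel) \<longlongrightarrow> integral\<^sup>L lborel (\<lambda>y::'a. 0)) at_top"
  proof (rule integral_dominated_convergence_at_top [where w = "\<lambda>y. \<bar>?f y\<bar>"])
    show "AE y in lborel. ((\<lambda>R. indicator (- ball 0 R) y * ?f y) \<longlongrightarrow> 0) at_top"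
    proof (rule AE_I2, rule tendsto_eventually)
      fix y :: 'a
      show "\<forall>\<^sub>F R in at_top. indicator (- ball 0 R) y * ?f y = 0"
        using eventually_gt_at_top [of "norm y"] by eventually_elim (simp add: indicator_def)
    qed
  qed (use int in \<open>auto simp: indicator_def intro!: always_eventually integrable_abs\<close>)
  moreover have "\<forall>\<^sub>F R in at_top. (\<integral>y. indicator (- ball 0 R) y * ?f y \<partial>lborel) = (LINT y:- ball 0 R|lborel. f y)"
    using eventually_ge_at_top [of r]
    by eventually_elim (auto simp: set_lebesgue_integral_def indicator_def intro!: Bochner_Integration.integral_cong)
  ultimately show ?thesis by (simp add: tendsto_cong)
qed

text \<open>The map h \<mapsto> x + c h with |c| = 1 preserves Lebesgue measure. The values c = 1
  and c = -1 serve to average over h and -h.\<close>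

lemma
  fixes f :: "'a::euclidean_space \<Rightarrow> real"
  assumes "f \<in> borel_measurable borel" and c: "\<bar>c\<bar> = 1"
  shows integral_lborel_isometry: "(\<integral>h. f (x + c *\<^sub>R h) \<partial>lborel) = (\<integral>y. f y \<partial>lborel)"
    and integrable_lborel_isometry: "integrable lborel (\<lambda>h. f (x + c *\<^sub>R h)) \<longleftrightarrow> integrable lborel f"
proof -
  have eq: "(lborel :: 'a measure) = distr lborel borel (\<lambda>h. x + c *\<^sub>R h)"
    using lborel_affine [of c x] c by (auto simp: density_1)
  show "(\<integral>h. f (x + c *\<^sub>R h) \<partial>lborel) = (\<integral>y. f y \<partial>lborel)"
    by (subst (2) eq, subst integral_distr) (use assms in auto)
  show "integrable lborel (\<lambda>h. f (x + c *\<^sub>R h)) \<longleftrightarrow> integrable lborel f"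
    by (subst (2) eq, subst integrable_distr_eq) (use assms in auto)
qed

section \<open>Integrability away from the centre\<close>

text \<open>With r = |x - y| \<ge> e one has |y| \<le> |x| + r \<le> (1 + |x| / e) r and 1 \<le> r /
  e; adding the q-th powers gives the bound. It transfers integrability from the weight at the
  origin to the kernel centred at x.\<close>

lemma kernel_le_tail_weight:
  fixes x y :: "'a::real_normed_vector"
  assumes "0 < e" "e \<le> norm (x - y)" "0 < q"
  shows "1 / norm (x - y) powr q \<le> (e powr (- q) + (1 + norm x / e) powr q) * (1 / (1 + norm y powr q))"
proof -
  let ?r = "norm (x - y)"
  have r: "0 < ?r" using assms by linarith
  have "norm y \<le> norm x + ?r" by (metis norm_minus_commute norm_triangle_sub)
  also have "norm x \<le> norm x / e * ?r"
    using assms mult_left_mono [of e ?r "norm x / e"] by simp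
  finally have "norm y powr q \<le> ((1 + norm x / e) * ?r) powr q"
    using assms by (intro powr_mono2) (auto simp: distrib_right)
  also have "\<dots> = (1 + norm x / e) powr q * ?r powr q"
    using assms by (simp add: powr_mult)
  finally have 1: "norm y powr q \<le> (1 + norm x / e) powr q * ?r powr q" .
  have "1 = e powr (- q) * e powr q" using assms by (simp add: powr_minus)
  also have "\<dots> \<le> e powr (- q) * ?r powr q"
    using assms by (intro mult_left_mono powr_mono2) auto
  finally have 2: "1 + norm y powr q \<le> (e powr (- q) + (1 + norm x / e) powr q) * ?r powr q"
    using 1 by (simp add: distrib_right)
  have "0 < 1 + norm y powr q" by (simp add: add_pos_nonneg)
  then show ?thesis using 2 r by (simp add: field_simps)
qed

lemma set_integrable_div_kernel:
  fixes f :: "'a::euclidean_space \<Rightarrow> real"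
  assumes "0 < e" "0 < q" and [measurable]: "f \<in> borel_measurable borel"
    and int: "integrable lborel (\<lambda>y. \<bar>f y\<bar> / (1 + norm y powr q))"
  shows "set_integrable lborel (- ball x e) (\<lambda>y. f y / norm (x - y) powr q)"
  unfolding set_integrable_def
proof (rule Bochner_Integration.integrable_bound)
  define C where "C = e powr (- q) + (1 + norm x / e) powr q"
  show "integrable lborel (\<lambda>y. C * (\<bar>f y\<bar> / (1 + norm y powr q)))"
    using int by (rule integrable_mult_right)
  have [measurable]: "- ball x e \<in> sets borel" by simp
  show "(\<lambda>y. indicator (- ball x e) y *\<^sub>R (f y / norm (x - y) powr q)) \<in> borel_measurable lborel"
    by measurable
  have C: "0 \<le> C" by (simp add: C_def)
  show "AE y in lborel. norm (indicator (- ball x e) y *\<^sub>R (f y / norm (x - y) powr q))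
      \<le> norm (C * (\<bar>f y\<bar> / (1 + norm y powr q)))"
  proof (rule AE_I2)
    fix y
    have nn: "0 \<le> C * (\<bar>f y\<bar> / (1 + norm y powr q))"
      using C by (intro mult_nonneg_nonneg divide_nonneg_nonneg add_nonneg_nonneg) auto
    show "norm (indicator (- ball x e) y *\<^sub>R (f y / norm (x - y) powr q))
        \<le> norm (C * (\<bar>f y\<bar> / (1 + norm y powr q)))"
    proof (cases "y \<in> ball x e")
      case False
      then have "1 / norm (x - y) powr q \<le> C * (1 / (1 + norm y powr q))"
        unfolding C_def using assms by (intro kernel_le_tail_weight) (auto simp: dist_norm)
      then have "\<bar>f y\<bar> * (1 / norm (x - y) powr q) \<le> \<bar>f y\<bar> * (C * (1 / (1 + norm y powr q)))"
        by (rule mult_left_mono) simp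
      then show ?thesis using False C by (simp add: abs_mult mult_ac)
    qed (use nn in simp)
  qed
qed

text \<open>The exponent \<open>q\<close> stands for n + \<sigma> p.\<close>

definition plap_integrand ::
    "real \<Rightarrow> real \<Rightarrow> ('a::real_normed_vector \<Rightarrow> real) \<Rightarrow> 'a \<Rightarrow> 'a \<Rightarrow> real" where
  "plap_integrand p q w x y = signed_powr p (w x - w y) / norm (x - y) powr q"

text \<open>Averaging the integrand over \<open>h\<close> and \<open>-h\<close> cancels its leading odd part, which turns the principal
  value into an absolutely convergent integral.\<close>

definition plap_sym ::
    "real \<Rightarrow> real \<Rightarrow> ('a::real_normed_vector \<Rightarrow> real) \<Rightarrow> 'a \<Rightarrow> 'a \<Rightarrow> real" where
  "plap_sym p q w x h =
     (signed_powr p (w x - w (x + h)) + signed_powr p (w x - w (x - h))) / 2 / norm h powr q"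

lemma borel_measurable_signed_powr:
  assumes "p > 2" "continuous_on UNIV w"
  shows "(\<lambda>y. signed_powr p (a - w y)) \<in> borel_measurable borel"
  by (intro borel_measurable_continuous_onI continuous_on_signed_powr continuous_intros assms)

lemma borel_measurable_plap_integrand:
  fixes x :: "'a::euclidean_space"
  assumes "p > 2" "continuous_on UNIV w"
  shows "plap_integrand p q w x \<in> borel_measurable borel"
proof -
  note [measurable] = borel_measurable_signed_powr [OF assms]
  show ?thesis unfolding plap_integrand_def [abs_def] by measurable
qed

lemma borel_measurable_plap_sym:
  fixes x :: "'a::euclidean_space"
  assumes "p > 2" "continuous_on UNIV w"
  shows "plap_sym p q w x \<in> borel_measurable borel"
proof -
  have [measurable]: "(\<lambda>h. signed_powr p (w x - w (x + h))) \<in> borel_measurable borel"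
    "(\<lambda>h. signed_powr p (w x - w (x - h))) \<in> borel_measurable borel"
    using assms by (auto intro!: borel_measurable_continuous_onI continuous_on_signed_powr
      continuous_intros continuous_on_compose2 [OF assms(2)])
  show ?thesis unfolding plap_sym_def [abs_def] by measurable
qed

text \<open>The version of \<open>tail_space\<close> for continuous functions, with the completed
  Lebesgue measure replaced by \<open>lborel\<close>.\<close>

definition tail_integrable :: "real \<Rightarrow> real \<Rightarrow> ('a::euclidean_space \<Rightarrow> real) \<Rightarrow> bool" where
  "tail_integrable p q w \<longleftrightarrow> continuous_on UNIV w \<and>
     integrable lborel (\<lambda>y. \<bar>w y\<bar> powr (p - 1) / (1 + norm y powr q))"

lemma tail_integrable_imp_borel_measurable:
  "tail_integrable p q w \<Longrightarrow> w \<in> borel_measurable borel"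
  by (auto simp: tail_integrable_def intro: borel_measurable_continuous_onI)

text \<open>The numerator is at most a multiple of |w(x)|^(p-1) + |w(y)|^(p-1). Against the weight,
  the first term is integrable because q > n, the second because of the tail condition.\<close>

lemma set_integrable_plap_integrand:
  fixes w :: "'a::euclidean_space \<Rightarrow> real"
  assumes "p > 2" "q > real DIM('a)" "tail_integrable p q w" "0 < e"
  shows "set_integrable lborel (- ball x e) (plap_integrand p q w x)"
  unfolding plap_integrand_def [abs_def]
proof (rule set_integrable_div_kernel)
  have w: "continuous_on UNIV w" using assms by (simp add: tail_integrable_def)
  show meas: "(\<lambda>y. signed_powr p (w x - w y)) \<in> borel_measurable borel"
    by (intro borel_measurable_signed_powr assms w)
  show "integrable lborel (\<lambda>y. \<bar>signed_powr p (w x - w y)\<bar> / (1 + norm y powr q))"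
  proof (rule Bochner_Integration.integrable_bound)
    show "integrable lborel (\<lambda>y. 2 powr (p - 1) * (\<bar>w x\<bar> powr (p - 1) * (1 / (1 + norm y powr q))
        + \<bar>w y\<bar> powr (p - 1) / (1 + norm y powr q)))"
      using assms(2,3) integrable_tail_weight [of q, where ?'a = 'a]
      by (intro integrable_mult_right Bochner_Integration.integrable_add) (auto simp: tail_integrable_def)
    show "(\<lambda>y. \<bar>signed_powr p (w x - w y)\<bar> / (1 + norm y powr q)) \<in> borel_measurable lborel"
      using meas by measurable
    show "AE y in lborel. norm (\<bar>signed_powr p (w x - w y)\<bar> / (1 + norm y powr q))
        \<le> norm (2 powr (p - 1) * (\<bar>w x\<bar> powr (p - 1) * (1 / (1 + norm y powr q))
        + \<bar>w y\<bar> powr (p - 1) / (1 + norm y powr q)))"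
    proof (rule AE_I2)
      fix y :: 'a
      have pos: "0 < 1 + norm y powr q" by (simp add: add_pos_nonneg)
      have "\<bar>signed_powr p (w x - w y)\<bar> / (1 + norm y powr q)
          \<le> 2 powr (p - 1) * (\<bar>w x\<bar> powr (p - 1) + \<bar>w y\<bar> powr (p - 1)) / (1 + norm y powr q)"
        using pos by (intro divide_right_mono abs_signed_powr_diff_le assms) auto
      also have "\<dots> = 2 powr (p - 1) * (\<bar>w x\<bar> powr (p - 1) * (1 / (1 + norm y powr q))
        + \<bar>w y\<bar> powr (p - 1) / (1 + norm y powr q))"
        by (simp add: add_divide_distrib algebra_simps)
      finally show "norm (\<bar>signed_powr p (w x - w y)\<bar> / (1 + norm y powr q))
        \<le> norm (2 powr (p - 1) * (\<bar>w x\<bar> powr (p - 1) * (1 / (1 + norm y powr q))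
        + \<bar>w y\<bar> powr (p - 1) / (1 + norm y powr q)))" using pos by simp
    qed
  qed
qed (use assms in \<open>auto intro: less_trans [of 0 "real DIM('a)"]\<close>)

lemma set_integrable_tail:
  fixes w :: "'a::euclidean_space \<Rightarrow> real"
  assumes "p > 2" "q > real DIM('a)" "tail_integrable p q w" "\<And>y. 0 \<le> w y" "0 < r"
  shows "set_integrable lborel (- ball 0 r) (\<lambda>y. w y powr (p - 1) / norm y powr q)"
proof -
  note [measurable] = tail_integrable_imp_borel_measurable [OF assms(3)]
  have "0 < q" using assms(2) by (rule less_trans [rotated]) simp
  then show ?thesis
    using set_integrable_div_kernel [of r q "\<lambda>y. w y powr (p - 1)" 0] assms
    by (simp add: tail_integrable_def)
qed

lemma set_integrable_kernel:
  assumes "q > real DIM('a)" "0 < r"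
  shows "set_integrable lborel (- ball (0::'a::euclidean_space) r) (\<lambda>y. 1 / norm y powr q)"
proof -
  have "0 < q" using assms(1) by (rule less_trans [rotated]) simp
  then show ?thesis
    using set_integrable_div_kernel [of r q "\<lambda>y::'a. 1" 0] assms integrable_tail_weight [of q, where ?'a = 'a]
    by simp
qed

section \<open>Symmetrization and existence of the principal value\<close>

text \<open>Outside a ball the symmetrized integrand is the mean of the original one at x + h and x
  - h, and both substitutions preserve the integral.\<close>

lemma
  fixes w :: "'a::euclidean_space \<Rightarrow> real"
  assumes "p > 2" "q > real DIM('a)" "tail_integrable p q w" "0 < e"
  shows integrable_plap_sym_outside:
      "integrable lborel (\<lambda>h. indicator (- ball 0 e) h * plap_sym p q w x h)"
    and integral_plap_sym_outside:
      "(\<integral>h. indicator (- ball 0 e) h * plap_sym p q w x h \<partial>lborel)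
        = (LINT y:- ball x e|lborel. plap_integrand p q w x y)"
proof -
  define f where "f = (\<lambda>y. indicator (- ball x e) y * plap_integrand p q w x y)"
  have int: "integrable lborel f" and val: "integral\<^sup>L lborel f = (LINT y:- ball x e|lborel. plap_integrand p q w x y)"
    using set_integrable_plap_integrand [OF assms, of x]
    by (simp_all add: f_def set_integrable_def set_lebesgue_integral_def)
  have m: "f \<in> borel_measurable borel" using borel_measurable_integrable [OF int] by simp
  note a = integral_lborel_isometry [OF m, of 1 x] integrable_lborel_isometry [OF m, of 1 x]
    integral_lborel_isometry [OF m, of "- 1" x] integrable_lborel_isometry [OF m, of "- 1" x]
  have eq: "indicator (- ball 0 e) h * plap_sym p q w x h = (f (x + h) + f (x - h)) / 2" for h
    by (simp add: f_def plap_sym_def plap_integrand_def indicator_def dist_norm add_divide_distrib)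
  show "integrable lborel (\<lambda>h. indicator (- ball 0 e) h * plap_sym p q w x h)"
    unfolding eq using a int by simp
  show "(\<integral>h. indicator (- ball 0 e) h * plap_sym p q w x h \<partial>lborel)
        = (LINT y:- ball x e|lborel. plap_integrand p q w x y)"
    unfolding eq val [symmetric] using a int by simp
qed

text \<open>The increments a and b for h and -h nearly cancel. As \<open>signed_powr\<close> is odd,
  the numerator is its difference at a and -b, of size (|a| + |b|)^(p-2) |a + b|: first differences
  enter with the power p - 2, and the second difference enters once.\<close>

lemma abs_plap_sym_le:
  fixes w :: "'a::euclidean_space \<Rightarrow> real"
  assumes "p > 2" "diffs_bounded r s C w x" "norm h \<le> 1" "0 \<le> C"
  shows "\<bar>plap_sym p q w x h\<bar> \<le> (p - 1) * (2 * C) powr (p - 2) * C * norm h powr (r * (p - 2) + s - q)"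
proof (cases "h = 0")
  case False
  define a b where "a = w x - w (x + h)" and "b = w x - w (x - h)"
  have a: "\<bar>a\<bar> \<le> C * norm h powr r" and b: "\<bar>b\<bar> \<le> C * norm h powr r"
    and ab: "\<bar>a + b\<bar> \<le> C * norm h powr s"
    using assms(2) [unfolded diffs_bounded_def, rule_format, of h]
      assms(2) [unfolded diffs_bounded_def, rule_format, of "- h"] assms(3)
    by (auto simp: a_def b_def)
  have "\<bar>signed_powr p a + signed_powr p b\<bar> = \<bar>signed_powr p a - signed_powr p (- b)\<bar>"
    by (simp add: signed_powr_minus)
  also have "\<dots> \<le> (p - 1) * (\<bar>a\<bar> + \<bar>- b\<bar>) powr (p - 2) * \<bar>a - - b\<bar>"
    by (rule signed_powr_diff_le [OF assms(1)])
  also have "\<dots> \<le> (p - 1) * (2 * C * norm h powr r) powr (p - 2) * (C * norm h powr s)"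
    using a b ab assms by (intro mult_mono powr_mono2) auto
  also have "\<dots> = (p - 1) * (2 * C) powr (p - 2) * C * norm h powr (r * (p - 2) + s)"
    using assms by (simp add: powr_mult powr_powr powr_add)
  finally have "\<bar>signed_powr p a + signed_powr p b\<bar> / 2 / norm h powr q
      \<le> (p - 1) * (2 * C) powr (p - 2) * C * norm h powr (r * (p - 2) + s) / norm h powr q"
    by (intro divide_right_mono) (auto intro: order.trans [rotated])
  then show ?thesis by (simp add: plap_sym_def a_def b_def powr_diff)
qed (simp add: plap_sym_def)

lemma integrable_plap_sym_majorant:
  assumes "q < real DIM('a) + (r * (p - 2) + s)"
  shows "integrable lborel (\<lambda>h::'a::euclidean_space. indicator (ball 0 1) h * (C * norm h powr (r * (p - 2) + s - q)))"
  using integrable_mult_right [OF integrable_norm_powr_ball [of "q - (r * (p - 2) + s)", where ?'a = 'a], of C] assms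
  by (simp add: mult_ac)

lemma integrable_plap_sym_inside:
  fixes w :: "'a::euclidean_space \<Rightarrow> real"
  assumes "p > 2" "continuous_on UNIV w" "diffs_bounded r s C w x" "q < real DIM('a) + (r * (p - 2) + s)"
  shows "integrable lborel (\<lambda>h. indicator (ball 0 1) h * plap_sym p q w x h)"
proof (rule Bochner_Integration.integrable_bound)
  \<comment> \<open>A unit vector as increment shows that the constant \<open>C\<close> is
    nonnegative.\<close>
  obtain b :: 'a where "b \<in> Basis" using nonempty_Basis by blast
  then have "\<bar>w (x + b) - w x\<bar> \<le> C"
    using assms(3) [unfolded diffs_bounded_def, rule_format, of b] by simp
  then have C: "0 \<le> C" by linarith
  let ?K = "(p - 1) * (2 * C) powr (p - 2) * C"
  show "integrable lborel (\<lambda>h::'a. indicator (ball 0 1) h * (?K * norm h powr (r * (p - 2) + s - q)))"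
    by (rule integrable_plap_sym_majorant [OF assms(4)])
  show "(\<lambda>h. indicator (ball 0 1) h * plap_sym p q w x h) \<in> borel_measurable lborel"
    using borel_measurable_plap_sym [OF assms(1,2)]
    by (intro borel_measurable_times borel_measurable_indicator) auto
  show "AE h in lborel. norm (indicator (ball 0 1) h * plap_sym p q w x h)
      \<le> norm (indicator (ball 0 1) h * (?K * norm h powr (r * (p - 2) + s - q)))"
    using abs_plap_sym_le [OF assms(1,3) _ C] assms(1) C
    by (auto simp: indicator_def abs_mult)
qed

text \<open>Each truncated integral equals that of \<open>plap_sym\<close> over the complement of a
  ball about 0. Since \<open>plap_sym\<close> is integrable on the whole space, dominated
  convergence removes the truncation. The limit is split at radius 1 because only the outer part can
  lose mass at infinity later.\<close>

lemma plap_principal_value: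
  fixes w :: "'a::euclidean_space \<Rightarrow> real"
  assumes "p > 2" "q > real DIM('a)" "tail_integrable p q w" "diffs_bounded r s C w x"
    "q < real DIM('a) + (r * (p - 2) + s)"
  shows "((\<lambda>e. LINT y:- ball x e|lborel. plap_integrand p q w x y) \<longlongrightarrow>
     (\<integral>h. indicator (ball 0 1) h * plap_sym p q w x h \<partial>lborel)
       + (LINT y:- ball x 1|lborel. plap_integrand p q w x y)) (at_right 0)"
proof -
  let ?S = "plap_sym p q w x"
  have w: "continuous_on UNIV w" using assms by (simp add: tail_integrable_def)
  note [measurable] = borel_measurable_plap_sym [OF assms(1) w, of q x]
  have i1: "integrable lborel (\<lambda>h. indicator (ball 0 1) h * ?S h)"
    by (rule integrable_plap_sym_inside [OF assms(1) w assms(4,5)])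
  have i2: "integrable lborel (\<lambda>h. indicator (- ball 0 1) h * ?S h)"
    by (rule integrable_plap_sym_outside [OF assms(1-3)]) simp
  have split: "?S h = indicator (ball 0 1) h * ?S h + indicator (- ball 0 1) h * ?S h" for h
    by (simp add: indicator_def)
  have int: "integrable lborel ?S"
    by (subst split [abs_def]) (intro Bochner_Integration.integrable_add i1 i2)
  have val: "integral\<^sup>L lborel ?S = (\<integral>h. indicator (ball 0 1) h * ?S h \<partial>lborel)
       + (LINT y:- ball x 1|lborel. plap_integrand p q w x y)"
    by (subst split [abs_def], subst Bochner_Integration.integral_add [OF i1 i2])
      (simp add: integral_plap_sym_outside [OF assms(1-3)])
  have "((\<lambda>e. LINT y:- ball x e|lborel. plap_integrand p q w x y) \<longlongrightarrow> integral\<^sup>L lborel ?S) (at_right 0)"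
  proof (rule tendsto_at_right_sequentially [where b = 1])
    fix X :: "nat \<Rightarrow> real"
    assume X: "\<And>n. 0 < X n" "X \<longlonglongrightarrow> 0"
    have [measurable]: "- ball (0::'a) e \<in> sets borel" for e by simp
    have "(\<lambda>n. \<integral>h. indicator (- ball 0 (X n)) h * ?S h \<partial>lborel) \<longlonglongrightarrow> integral\<^sup>L lborel ?S"
    proof (rule integral_dominated_convergence [where w = "\<lambda>h. \<bar>?S h\<bar>"])
      show "AE h in lborel. (\<lambda>n. indicator (- ball 0 (X n)) h * ?S h) \<longlonglongrightarrow> ?S h"
      proof (rule AE_I2)
        fix h :: 'a
        show "(\<lambda>n. indicator (- ball 0 (X n)) h * ?S h) \<longlonglongrightarrow> ?S h"
        proof (cases "h = 0")
          case False
          then have "\<forall>\<^sub>F n in sequentially. X n < norm h"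
            using order_tendstoD(2) [OF X(2)] by simp
          then have "\<forall>\<^sub>F n in sequentially. indicator (- ball 0 (X n)) h * ?S h = ?S h"
            by eventually_elim (simp add: indicator_def)
          then show ?thesis by (rule tendsto_eventually)
        qed (simp add: plap_sym_def)
      qed
    qed (use int in \<open>auto simp: indicator_def intro!: integrable_abs\<close>)
    then show "(\<lambda>n. LINT y:- ball x (X n)|lborel. plap_integrand p q w x y) \<longlonglongrightarrow> integral\<^sup>L lborel ?S"
      by (simp add: integral_plap_sym_outside [OF assms(1-3) X(1)])
  qed simp
  then show ?thesis by (simp add: val)
qed

text \<open>A bound on the differences that is uniform in i gives a majorant of
  \<open>plap_sym\<close> independent of i, so the near parts converge by dominated
  convergence.\<close>

lemma plap_sym_integral_tendsto:
  fixes u :: "nat \<Rightarrow> 'a::euclidean_space \<Rightarrow> real"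
  assumes "p > 2" "\<And>i. continuous_on UNIV (u i)" "continuous_on UNIV v"
    and lim: "\<And>y. (\<lambda>i. u i y) \<longlonglongrightarrow> v y"
    and bd: "\<forall>\<^sub>F i in sequentially. diffs_bounded r s C (u i) x"
    and q: "q < real DIM('a) + (r * (p - 2) + s)"
  shows "(\<lambda>i. \<integral>h. indicator (ball 0 1) h * plap_sym p q (u i) x h \<partial>lborel)
    \<longlonglongrightarrow> (\<integral>h. indicator (ball 0 1) h * plap_sym p q v x h \<partial>lborel)"
proof (rule integral_eventually_dominated_convergence)
  \<comment> \<open>The bound on \<open>plap_sym\<close> asks for a nonnegative constant.\<close>
  let ?D = "max C 0"
  let ?K = "(p - 1) * (2 * ?D) powr (p - 2) * ?D"
  show "integrable lborel (\<lambda>h::'a. indicator (ball 0 1) h * (?K * norm h powr (r * (p - 2) + s - q)))"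
    by (rule integrable_plap_sym_majorant [OF q])
  show "(\<lambda>h. indicator (ball 0 1) h * plap_sym p q (u i) x h) \<in> borel_measurable lborel" for i
    using borel_measurable_plap_sym [OF assms(1,2)]
    by (intro borel_measurable_times borel_measurable_indicator) auto
  show "(\<lambda>h. indicator (ball 0 1) h * plap_sym p q v x h) \<in> borel_measurable lborel"
    using borel_measurable_plap_sym [OF assms(1,3)]
    by (intro borel_measurable_times borel_measurable_indicator) auto
  show "(\<lambda>i. indicator (ball 0 1) h * plap_sym p q (u i) x h)
      \<longlonglongrightarrow> indicator (ball 0 1) h * plap_sym p q v x h" for h
  proof (cases "h = 0")
    case False
    then show ?thesis
      unfolding plap_sym_def by (intro tendsto_intros tendsto_signed_powr assms(1) lim) auto
  qed (simp add: plap_sym_def)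
  show "\<forall>\<^sub>F i in sequentially. \<forall>h. \<bar>indicator (ball 0 1) h * plap_sym p q (u i) x h\<bar>
      \<le> indicator (ball 0 1) h * (?K * norm h powr (r * (p - 2) + s - q))"
    using bd
  proof eventually_elim
    case (elim i)
    have "C * norm h powr t \<le> ?D * norm h powr t" for h :: 'a and t
      by (intro mult_right_mono) auto
    then have "diffs_bounded r s ?D (u i) x"
      using elim unfolding diffs_bounded_def by (meson order.trans)
    then show ?case
      using abs_plap_sym_le [OF assms(1), of r s ?D "u i" x _ q]
      by (auto simp: indicator_def)
  qed
qed

text \<open>The truncated integrals do converge, so \<open>Lim\<close> denotes their limit; the
  integrand is Borel, so integrals over \<open>lebesgue\<close> and \<open>lborel\<close>
  agree.\<close>

lemma frac_p_laplacian_eq: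
  fixes w :: "'a::euclidean_space \<Rightarrow> real"
  assumes "p > 2" "0 < \<sigma>" "tail_integrable p (real DIM('a) + \<sigma> * p) w"
    "diffs_bounded r s C w x" "\<sigma> * p < r * (p - 2) + s"
  shows "frac_p_laplacian c \<sigma> p w x = c *
     ((\<integral>h. indicator (ball 0 1) h * plap_sym p (real DIM('a) + \<sigma> * p) w x h \<partial>lborel)
       + (LINT y:- ball x 1|lborel. plap_integrand p (real DIM('a) + \<sigma> * p) w x y))"
proof -
  let ?q = "real DIM('a) + \<sigma> * p"
  have w: "continuous_on UNIV w" using assms by (simp add: tail_integrable_def)
  have eq: "(LINT y : - ball x e | lebesgue.
      \<bar>w x - w y\<bar> powr (p - 2) * (w x - w y) / norm (x - y) powr ?q)
      = (LINT y:- ball x e|lborel. plap_integrand p ?q w x y)" for e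
  proof -
    have "(\<lambda>y. indicator (- ball x e) y *\<^sub>R plap_integrand p ?q w x y) \<in> borel_measurable lborel"
      using borel_measurable_plap_integrand [OF assms(1) w]
      by (intro borel_measurable_scaleR borel_measurable_indicator) auto
    then show ?thesis
      unfolding set_lebesgue_integral_def
      by (subst integral_completion [symmetric]) (simp_all add: plap_integrand_def signed_powr_def)
  qed
  show ?thesis
    unfolding frac_p_laplacian_def eq
    by (subst tendsto_Lim [OF _ plap_principal_value [OF assms(1) _ assms(3,4)]]) (use assms in auto)
qed

section \<open>Comparison of far integrals with tails\<close>

text \<open>The quotient |x - y| / |y| differs from 1 by at most |x| / |y|, and t^(-q) is continuous
  at t = 1. This lets the kernel centred at x be replaced by the one centred at 0.\<close>

lemma kernel_ratio_tendsto_1: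
  fixes x :: "'a::real_normed_vector"
  assumes "0 < d"
  shows "\<forall>\<^sub>F R in at_top. \<forall>y. R \<le> norm y \<longrightarrow>
     \<bar>1 / norm (x - y) powr q - 1 / norm y powr q\<bar> \<le> d * (1 / norm y powr q)"
proof -
  have "isCont (\<lambda>t::real. t powr (- q)) 1" by (intro continuous_intros) auto
  then obtain r where r: "r > 0" "\<And>t. \<bar>t - 1\<bar> < r \<Longrightarrow> \<bar>t powr (- q) - 1\<bar> < d"
    using assms unfolding continuous_at_eps_delta dist_real_def by force
  show ?thesis
    using eventually_gt_at_top [of 0] eventually_gt_at_top [of "norm x / r"]
  proof eventually_elim
    case (elim R)
    show ?case
    proof (intro allI impI)
      fix y :: 'a assume y: "R \<le> norm y"
      let ?t = "norm (x - y) / norm y"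
      have y0: "0 < norm y" using y elim by linarith
      have "\<bar>norm (x - y) - norm y\<bar> \<le> norm x"
        using norm_triangle_ineq3 [of "y - x" y] by (simp add: norm_minus_commute)
      also have "norm x < r * norm y"
      proof -
        have "norm x < R * r" using elim(2) r(1) by (simp add: field_simps)
        also have "\<dots> \<le> norm y * r" using y r(1) by (intro mult_right_mono) auto
        finally show ?thesis by (simp add: mult.commute)
      qed
      finally have "\<bar>norm (x - y) - norm y\<bar> / norm y < r" using y0 by (simp add: field_simps)
      moreover have "\<bar>norm (x - y) - norm y\<bar> / norm y = \<bar>?t - 1\<bar>"
      proof -
        have "?t - 1 = (norm (x - y) - norm y) / norm y" using y0 by (simp add: diff_divide_distrib)
        then show ?thesis by (simp only: abs_divide abs_norm_cancel)
      qed
      ultimately have "\<bar>?t powr (- q) - 1\<bar> \<le> d" using r(2) [of ?t] by simp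
      then have "\<bar>?t powr (- q) - 1\<bar> * (1 / norm y powr q) \<le> d * (1 / norm y powr q)"
        by (rule mult_right_mono) simp
      moreover have "\<bar>?t powr (- q) - 1\<bar> * (1 / norm y powr q)
          = \<bar>(?t powr (- q) - 1) * (1 / norm y powr q)\<bar>" by (simp add: abs_mult)
      moreover have "(?t powr (- q) - 1) * (1 / norm y powr q) = 1 / norm (x - y) powr q - 1 / norm y powr q"
        using y0 by (simp add: powr_divide powr_minus field_simps)
      ultimately show "\<bar>1 / norm (x - y) powr q - 1 / norm y powr q\<bar> \<le> d * (1 / norm y powr q)"
        by metis
    qed
  qed
qed

text \<open>The radius depends on w only through the bounds \<open>A\<close> and \<open>M\<close>,
  which is what makes the estimate uniform along the sequence. The sum of the integrands is bounded
  by a small multiple of the tail integrand plus a multiple of the kernel, whose integral outside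
  B_R tends to 0.\<close>

lemma plap_far_estimate:
  fixes x :: "'a::euclidean_space"
  assumes "p > 2" "q > real DIM('a)" "0 < e"
  shows "\<forall>\<^sub>F R in at_top. \<forall>w :: 'a \<Rightarrow> real.
     tail_integrable p q w \<longrightarrow> (\<forall>y. 0 \<le> w y) \<longrightarrow> w x \<le> A \<longrightarrow>
     (LINT y:- ball 0 1|lborel. w y powr (p - 1) / norm y powr q) \<le> M \<longrightarrow>
     \<bar>(LINT y:- ball 0 R|lborel. plap_integrand p q w x y)
       + (LINT y:- ball 0 R|lborel. w y powr (p - 1) / norm y powr q)\<bar> \<le> e"
proof -
  \<comment> \<open>The tail will appear with the factor 3 d: 2 d because the kernel at x is at most
    twice the kernel at 0 when d \<le> 1, and d from exchanging the kernels. The choice makes this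
    contribution at most e / 2.\<close>
  define d where "d = min 1 (e / (6 * (\<bar>M\<bar> + 1)))"
  have d: "0 < d" "d \<le> 1" and dM: "3 * d * \<bar>M\<bar> \<le> e / 2"
  proof -
    show "0 < d" using assms by (simp add: d_def)
    show "d \<le> 1" by (simp add: d_def)
    have "3 * d * \<bar>M\<bar> \<le> 3 * (e / (6 * (\<bar>M\<bar> + 1))) * (\<bar>M\<bar> + 1)"
      using assms by (intro mult_mono) (auto simp: d_def)
    also have "\<dots> = e / 2" by (simp add: field_simps)
    finally show "3 * d * \<bar>M\<bar> \<le> e / 2" .
  qed
  obtain C where C: "C \<ge> 0" "\<And>a b. 0 \<le> a \<Longrightarrow> 0 \<le> b \<Longrightarrow>
      \<bar>signed_powr p (a - b) + b powr (p - 1)\<bar> \<le> d * b powr (p - 1) + C * a powr (p - 1)"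
    using signed_powr_add_le_eps [OF assms(1) d(1)] by blast
  let ?A = "max A 0 powr (p - 1)"
  have "((\<lambda>R. 2 * C * ?A * (LINT y:- ball (0::'a) R|lborel. 1 / norm y powr q)) \<longlongrightarrow> 2 * C * ?A * 0) at_top"
    by (intro tendsto_intros set_integral_outside_ball_tendsto_0 [of 1] set_integrable_kernel assms) simp
  then have ev: "\<forall>\<^sub>F R in at_top. 2 * C * ?A * (LINT y:- ball (0::'a) R|lborel. 1 / norm y powr q) < e / 2"
    using assms(3) by (intro order_tendstoD) auto
  show ?thesis
    using ev kernel_ratio_tendsto_1 [OF d(1), of x q] eventually_ge_at_top [of "norm x + 1"]
  proof eventually_elim
    case (elim R)
    have R: "1 \<le> R" "0 < R" using elim(3) norm_ge_zero [of x] by linarith+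
    show ?case
    proof (intro allI impI)
      fix w :: "'a \<Rightarrow> real"
      assume w: "tail_integrable p q w" "\<forall>y. 0 \<le> w y" "w x \<le> A"
        and M: "(LINT y:- ball 0 1|lborel. w y powr (p - 1) / norm y powr q) \<le> M"
      let ?T = "\<lambda>y. w y powr (p - 1) / norm y powr q" and ?F = "plap_integrand p q w x"
        and ?K = "\<lambda>y. 1 / norm y powr q"
      let ?B = "- ball (0::'a) R"
      have iT1: "set_integrable lborel (- ball 0 1) ?T"
        using w assms by (intro set_integrable_tail) auto
      have iT: "set_integrable lborel ?B ?T"
        using w assms R by (intro set_integrable_tail) auto
      have iK: "set_integrable lborel ?B ?K"
        using assms R by (intro set_integrable_kernel)
      have iF: "set_integrable lborel ?B ?F"
      proof (rule set_integrable_subset)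
        show "set_integrable lborel (- ball x 1) ?F"
          using w assms by (intro set_integrable_plap_integrand) auto
        show "?B \<subseteq> - ball x 1"
        proof (rule subsetI)
          fix y assume "y \<in> ?B"
          then show "y \<in> - ball x 1"
            using elim(3) norm_triangle_sub [of y x] by (simp add: dist_norm norm_minus_commute)
        qed
      qed simp
      have pt: "\<bar>?F y + ?T y\<bar> \<le> 3 * d * ?T y + 2 * C * ?A * ?K y" if y: "y \<in> ?B" for y
      proof -
        define k k' where "k = ?K y" and "k' = 1 / norm (x - y) powr q"
        define b where "b = w y powr (p - 1)"
        have kk: "\<bar>k' - k\<bar> \<le> d * k" using elim(2) y by (auto simp: k_def k'_def)
        have k: "0 \<le> k" "0 \<le> k'" "k' \<le> 2 * k" "0 \<le> b"
          using kk d mult_right_mono [of d 1 k] by (auto simp: k_def k'_def b_def abs_le_iff)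
        have a: "w x powr (p - 1) \<le> ?A" using w assms by (intro powr_mono2) auto
        have s: "\<bar>signed_powr p (w x - w y) + b\<bar> \<le> d * b + C * ?A"
          using C(2) [of "w x" "w y"] w mult_left_mono [OF a C(1)] by (simp add: b_def)
        \<comment> \<open>The first summand measures the error of replacing the signed power by
          \<open>- b\<close>, the second that of moving the kernel from x to 0.\<close>
        have "?F y + ?T y = (signed_powr p (w x - w y) + b) * k' + b * (k - k')"
          by (simp add: plap_integrand_def k_def k'_def b_def algebra_simps)
        also have "\<bar>\<dots>\<bar> \<le> \<bar>signed_powr p (w x - w y) + b\<bar> * k' + b * \<bar>k' - k\<bar>"
          using k by (intro abs_triangle_ineq [THEN order.trans]) (simp add: abs_mult abs_minus_commute)
        also have "\<dots> \<le> (d * b + C * ?A) * (2 * k) + b * (d * k)"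
          using s k kk d C by (intro add_mono mult_mono) auto
        also have "\<dots> = 3 * d * ?T y + 2 * C * ?A * ?K y"
          by (simp add: k_def b_def algebra_simps)
        finally show ?thesis .
      qed
      have "\<bar>(LINT y:?B|lborel. ?F y) + (LINT y:?B|lborel. ?T y)\<bar> = \<bar>LINT y:?B|lborel. ?F y + ?T y\<bar>"
        using iF iT by simp
      also have "\<dots> \<le> (LINT y:?B|lborel. \<bar>?F y + ?T y\<bar>)"
        using set_integral_norm_bound [OF set_integral_add(1) [OF iF iT]] by simp
      also have "\<dots> \<le> (LINT y:?B|lborel. 3 * d * ?T y + 2 * C * ?A * ?K y)"
        using iF iT iK pt by (intro set_integral_mono set_integrable_abs set_integral_add set_integrable_mult_right)
      also have "\<dots> = 3 * d * (LINT y:?B|lborel. ?T y) + 2 * C * ?A * (LINT y:?B|lborel. ?K y)"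
        using iT iK by (subst set_integral_add(2); (intro set_integrable_mult_right)?)
          (simp_all only: set_integral_mult_right)
      also have "(LINT y:?B|lborel. ?T y) \<le> (LINT y:- ball 0 1|lborel. ?T y)"
        unfolding set_lebesgue_integral_def
        by (rule Bochner_Integration.integral_mono) (use iT iT1 R in \<open>auto simp: set_integrable_def indicator_def\<close>)
      also have "\<dots> \<le> \<bar>M\<bar>" using M by simp
      also have "3 * d * \<bar>M\<bar> + 2 * C * ?A * (LINT y:?B|lborel. ?K y) \<le> e"
        using dM elim(1) by linarith
      finally show "\<bar>(LINT y:?B|lborel. ?F y) + (LINT y:?B|lborel. ?T y)\<bar> \<le> e"
        using d by (simp add: mult_left_mono)
    qed
  qed
qed

text \<open>At the centre 0 the two kernels coincide, so the pointwise inequality with e = 1/2 can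
  be integrated directly; half of the tail is absorbed on the left, whence the factor 2. This bounds
  tails by far integrals.\<close>

lemma tail_le_plap_far:
  assumes "p > 2" "q > real DIM('a)"
  shows "\<exists>C. \<forall>w :: 'a::euclidean_space \<Rightarrow> real.
     tail_integrable p q w \<longrightarrow> (\<forall>y. 0 \<le> w y) \<longrightarrow>
     (LINT y:- ball 0 1|lborel. w y powr (p - 1) / norm y powr q)
       \<le> C * w 0 powr (p - 1) - 2 * (LINT y:- ball 0 1|lborel. plap_integrand p q w 0 y)"
proof -
  obtain C where C: "C \<ge> 0" "\<And>a b. 0 \<le> a \<Longrightarrow> 0 \<le> b \<Longrightarrow>
      \<bar>signed_powr p (a - b) + b powr (p - 1)\<bar> \<le> 1 / 2 * b powr (p - 1) + C * a powr (p - 1)"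
    using signed_powr_add_le_eps [OF assms(1), of "1 / 2"] by auto
  show ?thesis
  proof (intro exI allI impI)
    fix w :: "'a \<Rightarrow> real"
    assume w: "tail_integrable p q w" "\<forall>y. 0 \<le> w y"
    let ?T = "\<lambda>y. w y powr (p - 1) / norm y powr q" and ?F = "plap_integrand p q w 0"
      and ?K = "\<lambda>y. 1 / norm y powr q"
    let ?B = "- ball (0::'a) 1"
    have iT: "set_integrable lborel ?B ?T"
      using w assms by (intro set_integrable_tail) auto
    have iK: "set_integrable lborel ?B ?K"
      using assms by (intro set_integrable_kernel) auto
    have iF: "set_integrable lborel ?B ?F"
      using w assms by (intro set_integrable_plap_integrand) auto
    have pt: "?T y \<le> 2 * C * w 0 powr (p - 1) * ?K y - 2 * ?F y" for y
    proof -
      have "w y powr (p - 1) \<le> 2 * C * w 0 powr (p - 1) - 2 * signed_powr p (w 0 - w y)"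
        using C(2) [of "w 0" "w y"] w(2) by (simp add: abs_le_iff)
      then have "w y powr (p - 1) / norm y powr q
          \<le> (2 * C * w 0 powr (p - 1) - 2 * signed_powr p (w 0 - w y)) / norm y powr q"
        by (rule divide_right_mono) simp
      then show ?thesis by (simp add: plap_integrand_def diff_divide_distrib)
    qed
    have "(LINT y:?B|lborel. ?T y) \<le> (LINT y:?B|lborel. 2 * C * w 0 powr (p - 1) * ?K y - 2 * ?F y)"
      using iF iT iK pt by (intro set_integral_mono set_integral_diff set_integrable_mult_right)
    also have "\<dots> = 2 * C * w 0 powr (p - 1) * (LINT y:?B|lborel. ?K y) - 2 * (LINT y:?B|lborel. ?F y)"
      using iF iK by (subst set_integral_diff(2); (intro set_integrable_mult_right)?)
        (simp_all only: set_integral_mult_right)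
    finally show "(LINT y:?B|lborel. ?T y)
        \<le> (2 * C * (LINT y:?B|lborel. ?K y)) * w 0 powr (p - 1) - 2 * (LINT y:?B|lborel. ?F y)"
      by (simp add: mult_ac)
  qed
qed

section \<open>Passage to the limit\<close>

lemma convergent_if_approx_convergent:
  fixes X :: "nat \<Rightarrow> real"
  assumes "\<And>e. e > 0 \<Longrightarrow> \<exists>Y. convergent Y \<and> (\<forall>i. \<bar>X i - Y i\<bar> \<le> e)"
  shows "convergent X"
proof (rule Cauchy_convergent, rule metric_CauchyI)
  fix e :: real assume "e > 0"
  then obtain Y where Y: "convergent Y" "\<And>i. \<bar>X i - Y i\<bar> \<le> e / 4"
    using assms [of "e / 4"] by auto
  then have "Cauchy Y" by (simp add: convergent_Cauchy)
  then obtain N where N: "\<And>m n. m \<ge> N \<Longrightarrow> n \<ge> N \<Longrightarrow> dist (Y m) (Y n) < e / 4"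
    using \<open>e > 0\<close> metric_CauchyD [of Y "e / 4"] by auto
  have "dist (X m) (X n) < e" if "m \<ge> N" "n \<ge> N" for m n
    using N [OF that] Y(2) [of m] Y(2) [of n] \<open>e > 0\<close> unfolding dist_real_def by linarith
  then show "\<exists>N. \<forall>m\<ge>N. \<forall>n\<ge>N. dist (X m) (X n) < e" by blast
qed

lemma eventually_bounded_of_uniform_limit:
  fixes u :: "nat \<Rightarrow> 'a::euclidean_space \<Rightarrow> real"
  assumes "uniform_limit K u v sequentially" "continuous_on K v" "compact K"
  shows "\<exists>B\<ge>0. \<forall>\<^sub>F i in sequentially. \<forall>y\<in>K. \<bar>u i y\<bar> \<le> B"
proof -
  have "bounded (v ` K)" using assms compact_continuous_image compact_imp_bounded by blast
  then obtain B where B: "0 < B" "\<And>y. y \<in> K \<Longrightarrow> \<bar>v y\<bar> \<le> B"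
    by (auto simp: bounded_pos)
  have "\<forall>\<^sub>F i in sequentially. \<forall>y\<in>K. dist (u i y) (v y) < 1"
    using assms(1) by (rule uniform_limitD) simp
  then have "\<forall>\<^sub>F i in sequentially. \<forall>y\<in>K. \<bar>u i y\<bar> \<le> B + 1"
    by eventually_elim (force simp: dist_real_def dest: B(2))
  then show ?thesis using B(1) by (intro exI [of _ "B + 1"]) auto
qed

text \<open>The region is bounded and has distance at least 1 from x, so the kernel is at most 1
  there. The condition on R also puts x into the ball on which the u_i are eventually uniformly
  bounded.\<close>

lemma plap_integrand_integral_tendsto:
  fixes u :: "nat \<Rightarrow> 'a::euclidean_space \<Rightarrow> real"
  assumes "p > 2" "q > 0" "\<And>i. continuous_on UNIV (u i)" "continuous_on UNIV v"
    and ul: "\<And>K. compact K \<Longrightarrow> uniform_limit K u v sequentially" and R: "norm x + 1 \<le> R"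
  shows "(\<lambda>i. LINT y:ball 0 R - ball x 1|lborel. plap_integrand p q (u i) x y)
    \<longlonglongrightarrow> (LINT y:ball 0 R - ball x 1|lborel. plap_integrand p q v x y)"
proof -
  have lim: "(\<lambda>i. u i y) \<longlonglongrightarrow> v y" for y
    using ul [of "{y}"] by (auto intro: tendsto_uniform_limitI)
  have "continuous_on (cball 0 R) v" using assms(4) continuous_on_subset by blast
  then obtain B where B: "0 \<le> B" "\<forall>\<^sub>F i in sequentially. \<forall>y\<in>cball 0 R. \<bar>u i y\<bar> \<le> B"
    using eventually_bounded_of_uniform_limit [OF ul, of "cball 0 R"] by auto
  let ?C = "2 powr (p - 1) * (B powr (p - 1) + B powr (p - 1))"
  show ?thesis
  proof (rule set_integral_bounded_convergence [where R = R and B = ?C])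
    show "plap_integrand p q (u i) x \<in> borel_measurable borel" for i
      by (intro borel_measurable_plap_integrand assms)
    show "plap_integrand p q v x \<in> borel_measurable borel"
      by (intro borel_measurable_plap_integrand assms)
    fix y assume "y \<in> ball 0 R - ball x 1"
    then have "norm (x - y) powr q \<noteq> 0" by (auto simp: dist_norm)
    then show "(\<lambda>i. plap_integrand p q (u i) x y) \<longlonglongrightarrow> plap_integrand p q v x y"
      unfolding plap_integrand_def by (intro tendsto_intros tendsto_signed_powr assms(1) lim)
  next
    show "\<forall>\<^sub>F i in sequentially. \<forall>y\<in>ball 0 R - ball x 1. \<bar>plap_integrand p q (u i) x y\<bar> \<le> ?C"
      using B(2)
    proof eventually_elim
      case (elim i)
      show ?case
      proof
        fix y assume y: "y \<in> ball 0 R - ball x 1"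
        then have "1 \<le> norm (x - y) powr q"
          using assms(2) by (intro ge_one_powr_ge_zero) (auto simp: dist_norm)
        then have "\<bar>plap_integrand p q (u i) x y\<bar> \<le> \<bar>signed_powr p (u i x - u i y)\<bar>"
          by (simp add: plap_integrand_def divide_le_eq mult_left_le) 
            (metis abs_ge_zero mult.right_neutral mult_left_mono)
        also have "\<dots> \<le> 2 powr (p - 1) * (\<bar>u i x\<bar> powr (p - 1) + \<bar>u i y\<bar> powr (p - 1))"
          by (rule abs_signed_powr_diff_le [OF assms(1)])
        also have "\<dots> \<le> ?C"
          using elim y R assms(1) by (intro mult_left_mono add_mono powr_mono2) auto
        finally show "\<bar>plap_integrand p q (u i) x y\<bar> \<le> ?C" .
      qed
    qed
  qed auto
qed

lemma tail_integral_tendsto: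
  fixes u :: "nat \<Rightarrow> 'a::euclidean_space \<Rightarrow> real"
  assumes "p > 2" "q > 0" "\<And>i. continuous_on UNIV (u i)" "continuous_on UNIV v" "\<And>i y. 0 \<le> u i y"
    and ul: "\<And>K. compact K \<Longrightarrow> uniform_limit K u v sequentially" and r: "0 < r"
  shows "(\<lambda>i. LINT y:ball 0 R - ball 0 r|lborel. u i y powr (p - 1) / norm y powr q)
    \<longlonglongrightarrow> (LINT y:ball 0 R - ball 0 r|lborel. v y powr (p - 1) / norm y powr q)"
proof -
  have lim: "(\<lambda>i. u i y) \<longlonglongrightarrow> v y" for y
    using ul [of "{y}"] by (auto intro: tendsto_uniform_limitI)
  then have v: "0 \<le> v y" for y using assms(5) LIMSEQ_le_const by blast
  have "continuous_on (cball 0 R) v" using assms(4) continuous_on_subset by blast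
  then obtain B where B: "0 \<le> B" "\<forall>\<^sub>F i in sequentially. \<forall>y\<in>cball 0 R. \<bar>u i y\<bar> \<le> B"
    using eventually_bounded_of_uniform_limit [OF ul, of "cball 0 R"] by auto
  note [measurable] = assms(3,4) [THEN borel_measurable_continuous_onI]
  show ?thesis
  proof (rule set_integral_bounded_convergence [where R = R and B = "B powr (p - 1) / r powr q"])
    fix y :: 'a assume "y \<in> ball 0 R - ball 0 r"
    then have "norm y powr q \<noteq> 0" using r by auto
    moreover have "(\<lambda>i. u i y powr (p - 1)) \<longlonglongrightarrow> v y powr (p - 1)"
      using tendsto_signed_powr [OF assms(1) lim, of y] by (simp add: signed_powr_nonneg v assms(5))
    ultimately show "(\<lambda>i. u i y powr (p - 1) / norm y powr q) \<longlonglongrightarrow> v y powr (p - 1) / norm y powr q"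
      by (intro tendsto_divide tendsto_const)
  next
    show "\<forall>\<^sub>F i in sequentially. \<forall>y\<in>ball 0 R - ball 0 r.
        \<bar>u i y powr (p - 1) / norm y powr q\<bar> \<le> B powr (p - 1) / r powr q"
      using B(2)
    proof eventually_elim
      case (elim i)
      show ?case
      proof
        fix y :: 'a assume y: "y \<in> ball 0 R - ball 0 r"
        have "u i y powr (p - 1) / norm y powr q \<le> B powr (p - 1) / r powr q"
          using y elim assms(1,2,5) r by (intro frac_le powr_mono2) (auto simp: abs_le_iff)
        then show "\<bar>u i y powr (p - 1) / norm y powr q\<bar> \<le> B powr (p - 1) / r powr q" by simp
      qed
    qed
  qed auto
qed

lemma tail_space_imp_tail_integrable:
  fixes w :: "'a::euclidean_space \<Rightarrow> real"
  assumes "w \<in> tail_space \<sigma> p" "continuous_on UNIV w"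
  shows "tail_integrable p (real DIM('a) + \<sigma> * p) w"
proof -
  note [measurable] = borel_measurable_continuous_onI [OF assms(2)]
  show ?thesis using assms by (simp add: tail_space_def tail_integrable_def integrable_completion)
qed

text \<open>As \<open>plap_sym\<close> is of order \<open>\<bar>h\<bar>\<close> to the power \<open>min s 1 * (p - 2) + min s 2 - n - \<sigma> * p\<close>, this makes it
  integrable at the origin.\<close>

lemma symmetrized_exponent_gt:
  fixes p \<sigma> s :: real
  assumes "p > 2" "\<sigma> < 1" "s > \<sigma> * p" "s > 0"
  shows "\<sigma> * p < min s 1 * (p - 2) + min s 2"
proof -
  \<comment> \<open>There are three regimes: s (p - 2) + s > s for s \<le> 1, then p - 2 + s > s for
    1 < s \<le> 2, where s > \<sigma> p in both, and finally p > \<sigma> p for s > 2.\<close>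
  have "\<sigma> * p < p" using assms by simp
  have "0 < s * (p - 2)" using assms by simp
  show ?thesis
  proof (cases "s \<le> 1")
    case True
    then have "min s 1 = s" "min s 2 = s" by simp_all
    then show ?thesis using \<open>0 < s * (p - 2)\<close> assms(3) by linarith
  next
    case False
    then have "min s 1 = 1" by simp
    then show ?thesis using \<open>\<sigma> * p < p\<close> assms(1,3) by (cases "s \<le> 2") simp_all
  qed
qed

text \<open>The convergence of \<open>T i R\<close> in \<open>i\<close> is part of the conclusion,
  because \<open>lim\<close> denotes an actual limit only for a convergent sequence. The constant
  c_{n,\<sigma> p} is represented by an arbitrary positive \<open>c\<close>.\<close>

theorem theorem1p1:
  fixes u :: "nat \<Rightarrow> 'a::euclidean_space \<Rightarrow> real" and v :: "'a \<Rightarrow> real"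
    and p \<sigma> \<alpha> c :: real
  assumes "p > 2" and "0 < \<sigma>" and "\<sigma> < 1" and "\<alpha> > 0" and "c > 0"
    and "\<And>i x. 0 \<le> u i x"
    and "\<And>i. u i \<in> tail_space \<sigma> p \<inter> C_loc (\<sigma> * p + \<alpha>)"
    and "v \<in> tail_space \<sigma> p"
    and "C_loc_tendsto (\<sigma> * p + \<alpha>) u v"
    and "\<And>x. convergent (\<lambda>i. frac_p_laplacian c \<sigma> p (u i) x)"
  defines "T \<equiv> \<lambda>i R. LINT y : - ball 0 R | lebesgue.
                  u i y powr (p - 1) / norm y powr (real DIM('a) + \<sigma> * p)"
  shows "\<exists>\<theta> l. \<theta> = c * l \<and> \<theta> \<ge> 0
     \<and> (\<forall>R>0. convergent (\<lambda>i. T i R))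
     \<and> ((\<lambda>R. lim (\<lambda>i. T i R)) \<longlongrightarrow> l) at_top
     \<and> (\<forall>x. (\<lambda>i. frac_p_laplacian c \<sigma> p (u i) x) \<longlonglongrightarrow> frac_p_laplacian c \<sigma> p v x - \<theta>)"
proof -

  \<comment> \<open>Exponents and regularity\<close>
  define q where "q = real DIM('a) + \<sigma> * p"
  define s where "s = \<sigma> * p + \<alpha>"
  define r t where "r = min s 1" and "t = min s 2"
  have q: "q > real DIM('a)" "q > 0" using assms by (auto simp: q_def add_pos_pos)
  have s: "s > \<sigma> * p" "s > 0" using assms by (auto simp: s_def add_pos_pos)
  have ex: "\<sigma> * p < r * (p - 2) + t"
    unfolding r_def t_def using assms s by (intro symmetrized_exponent_gt)
  then have exq: "q < real DIM('a) + (r * (p - 2) + t)" by (simp add: q_def)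
  have conv: "C_loc_tendsto s u v" and u_C: "u i \<in> C_loc s" for i
    using assms(7,9) by (auto simp: s_def)
  then have v_C: "v \<in> C_loc s"
    by (simp add: C_loc_tendsto_def holder_loc_tendsto_def C_loc_def)
  have cont: "continuous_on UNIV (u i)" "continuous_on UNIV v" for i
    using u_C v_C Ck_imp_continuous_on by (auto simp: C_loc_def holder_loc_def)
  have ti: "tail_integrable p q (u i)" "tail_integrable p q v" for i
    unfolding q_def using assms(7,8) cont by (auto intro!: tail_space_imp_tail_integrable)
  have ul: "uniform_limit K u v sequentially" if "compact K" for K
    using conv that by (rule uniform_limit_of_C_loc_tendsto)
  have lim: "(\<lambda>i. u i y) \<longlonglongrightarrow> v y" for y
    using ul [of "{y}"] by (auto intro: tendsto_uniform_limitI)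

  \<comment> \<open>Near and far parts of the operator\<close>
  \<comment> \<open>\<open>N\<close> is the symmetrized part at distance less than 1 from x, and
    \<open>I\<close> integrates over a given set; the operator is c times the sum of
    \<open>N\<close> and of \<open>I\<close> over the complement of the unit ball about x.\<close>
  define N where "N = (\<lambda>(w :: 'a \<Rightarrow> real) x. \<integral>h. indicator (ball 0 1) h * plap_sym p q w x h \<partial>lborel)"
  define I where "I = (\<lambda>(w :: 'a \<Rightarrow> real) x A. LINT y:A|lborel. plap_integrand p q w x y)"
  have frac: "frac_p_laplacian c \<sigma> p w x = c * (N w x + I w x (- ball x 1))"
    if "tail_integrable p q w" "w \<in> C_loc s" for w x
    using C_loc_imp_diffs_bounded [OF s(2) that(2), of x] that ex assms(1,2)
    unfolding N_def I_def q_def r_def [symmetric] t_def [symmetric]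
    by (auto intro!: frac_p_laplacian_eq)
  have N: "(\<lambda>i. N (u i) x) \<longlonglongrightarrow> N v x" for x
  proof -
    obtain C where "\<forall>\<^sub>F i in sequentially. diffs_bounded r t C (u i) x"
      using eventually_diffs_bounded_of_C_loc_tendsto [OF s(2) conv] unfolding r_def t_def by blast
    from plap_sym_integral_tendsto [OF assms(1) cont lim this exq] show ?thesis
      unfolding N_def .
  qed
  have split: "I w x (- ball x 1) = I w x (ball 0 R - ball x 1) + I w x (- ball 0 R)"
    if "tail_integrable p q w" "norm x + 1 \<le> R" for w x R
  proof -
    have i: "set_integrable lborel (- ball x 1) (plap_integrand p q w x)"
      using assms q that by (intro set_integrable_plap_integrand) auto
    have b: "ball x 1 \<subseteq> ball 0 R"
    proof (rule subsetI)
      fix y assume "y \<in> ball x 1"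
      then show "y \<in> ball 0 R"
        using that(2) norm_triangle_sub [of y x] by (simp add: dist_norm norm_minus_commute)
    qed
    then have sub: "- ball x 1 = (ball 0 R - ball x 1) \<union> - ball 0 R" by auto
    show ?thesis unfolding I_def
      by (subst sub, rule set_integral_Un) (use b in \<open>auto intro!: set_integrable_subset [OF i]\<close>)
  qed

  \<comment> \<open>Convergence of the far integrals\<close>
  define L where "L = (\<lambda>x. lim (\<lambda>i. frac_p_laplacian c \<sigma> p (u i) x))"
  have L: "(\<lambda>i. frac_p_laplacian c \<sigma> p (u i) x) \<longlonglongrightarrow> L x" for x
    using assms(10) by (simp add: L_def convergent_LIMSEQ_iff)
  have far: "(\<lambda>i. I (u i) x (- ball x 1)) \<longlonglongrightarrow> L x / c - N v x" for x
  proof -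
    have "(\<lambda>i. frac_p_laplacian c \<sigma> p (u i) x / c - N (u i) x) \<longlonglongrightarrow> L x / c - N v x"
      using assms(5) by (intro tendsto_intros L N) auto
    then show ?thesis using assms(5) by (simp add: frac ti u_C)
  qed
  \<comment> \<open>The parts inside B_R converge to those of v, so any discrepancy between
    \<open>L x\<close> and the operator at v must come from outside B_R. It is the same for all
    these R.\<close>
  have I_lim: "(\<lambda>i. I (u i) x (- ball 0 R)) \<longlonglongrightarrow>
      (L x - frac_p_laplacian c \<sigma> p v x) / c + I v x (- ball 0 R)" if "norm x + 1 \<le> R" for x R
  proof -
    have "(\<lambda>i. I (u i) x (- ball x 1) - I (u i) x (ball 0 R - ball x 1))
        \<longlonglongrightarrow> (L x / c - N v x) - I v x (ball 0 R - ball x 1)"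
      unfolding I_def
      by (intro tendsto_diff plap_integrand_integral_tendsto assms(1) q cont ul that far [unfolded I_def])
    then show ?thesis
      using assms(5) by (simp add: split [OF ti(1) that] frac [OF ti(2) v_C] split [OF ti(2) that] field_simps)
  qed

  \<comment> \<open>Uniform control of the tails\<close>
  have T: "T i R = (LINT y:- ball 0 R|lborel. u i y powr (p - 1) / norm y powr q)" for i R
  proof -
    note [measurable] = cont(1) [THEN borel_measurable_continuous_onI]
    have [measurable]: "- ball (0::'a) R \<in> sets borel" by simp
    show ?thesis unfolding T_def q_def set_lebesgue_integral_def
      by (rule integral_completion) measurable
  qed
  \<comment> \<open>For x = 0 the far region is the complement of B_1, the domain of
    \<open>T i 1\<close>. The right side converges, hence is bounded in \<open>i\<close>.\<close>
  obtain C where C: "\<And>i. T i 1 \<le> C * u i 0 powr (p - 1) - 2 * I (u i) 0 (- ball 0 1)"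
    using tail_le_plap_far [OF assms(1) q(1)] ti assms(6) unfolding T I_def by blast
  have "(\<lambda>i. u i 0 powr (p - 1)) \<longlonglongrightarrow> signed_powr p (v 0)"
    using tendsto_signed_powr [OF assms(1) lim, of 0] by (simp add: signed_powr_nonneg assms(6))
  then have "(\<lambda>i. C * u i 0 powr (p - 1) - 2 * I (u i) 0 (- ball 0 1))
      \<longlonglongrightarrow> C * signed_powr p (v 0) - 2 * (L 0 / c - N v 0)"
    by (intro tendsto_diff tendsto_mult tendsto_const far)
  then have "Bseq (\<lambda>i. C * u i 0 powr (p - 1) - 2 * I (u i) 0 (- ball 0 1))"
    by (intro convergent_imp_Bseq convergentI)
  then obtain M where "\<And>i. \<bar>C * u i 0 powr (p - 1) - 2 * I (u i) 0 (- ball 0 1)\<bar> \<le> M"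
    by (auto simp: Bseq_def)
  then have M: "T i 1 \<le> M" for i
    using C [of i] by (meson abs_le_D1 order.trans)
  obtain A where A: "\<And>i x. u i x \<le> A x"
  proof -
    have "\<exists>A. \<forall>i. u i x \<le> A" for x
      using convergentI [OF lim [of x], THEN convergent_imp_Bseq, THEN BseqD] by (auto simp: abs_le_iff)
    then obtain A where "\<forall>x i. u i x \<le> A x" using choice [of "\<lambda>x A. \<forall>i. u i x \<le> A"] by blast
    then show thesis using that by blast
  qed
  \<comment> \<open>\<open>A x\<close> and \<open>M\<close> do not depend on \<open>i\<close>, so a
    single threshold for R serves all indices.\<close>
  have est: "\<forall>\<^sub>F R in at_top. \<forall>i. \<bar>I (u i) x (- ball 0 R) + T i R\<bar> \<le> e" if "e > 0" for x e
    using plap_far_estimate [OF assms(1) q(1) that, of x "A x" M]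
  proof eventually_elim
    case (elim R)
    show ?case
    proof
      fix i
      show "\<bar>I (u i) x (- ball 0 R) + T i R\<bar> \<le> e"
        using elim [rule_format, OF ti(1) assms(6) A M [unfolded T]] by (simp only: I_def T)
    qed
  qed

  \<comment> \<open>Convergence of the tails for fixed radius\<close>
  have T_conv: "convergent (\<lambda>i. T i R)" if "0 < R" for R
  proof (rule convergent_if_approx_convergent)
    \<comment> \<open>Choose S \<ge> R so large that \<open>T i S\<close> is within e of
      \<open>- I (u i) 0 (- ball 0 S)\<close>. This far integral converges because S \<ge> 1, and so
      does the integral \<open>Z\<close> over the annulus, so
      \<open>Z i - I (u i) 0 (- ball 0 S)\<close> is the approximating sequence.\<close>
    fix e :: real assume "e > 0"
    then have "\<forall>\<^sub>F S in at_top. S \<ge> max R 1 \<and> (\<forall>i. \<bar>I (u i) 0 (- ball 0 S) + T i S\<bar> \<le> e)"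
      by (intro eventually_conj eventually_ge_at_top est)
    from eventually_happens' [OF trivial_limit_at_top_linorder this]
    obtain S where S: "R \<le> S" "1 \<le> S" "\<And>i. \<bar>I (u i) 0 (- ball 0 S) + T i S\<bar> \<le> e"
      by auto
    define Z where "Z = (\<lambda>i. LINT y:ball 0 S - ball 0 R|lborel. u i y powr (p - 1) / norm y powr q)"
    have "T i R = Z i + T i S" for i
    proof -
      have i: "set_integrable lborel (- ball 0 R) (\<lambda>y. u i y powr (p - 1) / norm y powr q)"
        using assms q ti that by (intro set_integrable_tail) auto
      have sub: "- ball 0 R = (ball 0 S - ball 0 R) \<union> - ball (0::'a) S" using S by auto
      show ?thesis unfolding T Z_def
        by (subst sub, rule set_integral_Un) (use S in \<open>auto intro!: set_integrable_subset [OF i]\<close>)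
    qed
    then have "T i R - (Z i - I (u i) 0 (- ball 0 S)) = I (u i) 0 (- ball 0 S) + T i S" for i
      by simp
    then have "\<bar>T i R - (Z i - I (u i) 0 (- ball 0 S))\<bar> \<le> e" for i
      using S(3) by (simp only:)
    moreover have "convergent Z" unfolding Z_def
      by (rule convergentI [OF tail_integral_tendsto [OF assms(1) q(2) cont assms(6) ul that]])
    then have "convergent (\<lambda>i. Z i - I (u i) 0 (- ball 0 S))"
      using S by (intro convergent_diff convergentI [OF I_lim]) auto
    ultimately show "\<exists>Y. convergent Y \<and> (\<forall>i. \<bar>T i R - Y i\<bar> \<le> e)" by blast
  qed

  \<comment> \<open>The limit in the radius and the constant\<close>
  define l where "l = (frac_p_laplacian c \<sigma> p v 0 - L 0) / c"
  let ?T = "\<lambda>R. lim (\<lambda>i. T i R)"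
  \<comment> \<open>For fixed R the uniform estimate survives i \<rightarrow> \<infinity>; then R
    \<rightarrow> \<infinity>, where the far integral of v vanishes by integrability.\<close>
  have T_lim: "(?T \<longlongrightarrow> (frac_p_laplacian c \<sigma> p v x - L x) / c) at_top" for x
  proof -
    let ?k = "(L x - frac_p_laplacian c \<sigma> p v x) / c"
    have "((\<lambda>R. ?k + I v x (- ball 0 R) + ?T R) \<longlongrightarrow> 0) at_top"
    proof (rule tendstoI)
      fix e :: real assume "e > 0"
      then have "\<forall>\<^sub>F R in at_top. \<forall>i. \<bar>I (u i) x (- ball 0 R) + T i R\<bar> \<le> e / 2"
        by (intro est) simp
      then show "\<forall>\<^sub>F R in at_top. dist (?k + I v x (- ball 0 R) + ?T R) 0 < e"
        using eventually_ge_at_top [of "norm x + 1"]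
      proof eventually_elim
        case (elim R)
        then have "0 < R" using norm_ge_zero [of x] by linarith
        then have "(\<lambda>i. \<bar>I (u i) x (- ball 0 R) + T i R\<bar>) \<longlonglongrightarrow> \<bar>?k + I v x (- ball 0 R) + ?T R\<bar>"
          using T_conv elim(2) by (intro tendsto_intros I_lim) (auto simp: convergent_LIMSEQ_iff)
        then have "\<bar>?k + I v x (- ball 0 R) + ?T R\<bar> \<le> e / 2"
          using elim(1) by (intro LIMSEQ_le_const2) auto
        then show ?case using \<open>e > 0\<close> by simp
      qed
    qed
    moreover have "((\<lambda>R. I v x (- ball 0 R)) \<longlongrightarrow> 0) at_top"
    proof -
      have "set_integrable lborel (- ball 0 (norm x + 1)) (plap_integrand p q v x)"
      proof (rule set_integrable_subset)
        show "set_integrable lborel (- ball x 1) (plap_integrand p q v x)"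
          using assms q ti by (intro set_integrable_plap_integrand) auto
        show "- ball 0 (norm x + 1) \<subseteq> - ball x 1"
        proof (rule subsetI)
          fix y :: 'a assume "y \<in> - ball 0 (norm x + 1)"
          then show "y \<in> - ball x 1"
            using norm_triangle_sub [of y x] by (simp add: dist_norm norm_minus_commute)
        qed
      qed simp
      then show ?thesis unfolding I_def by (rule set_integral_outside_ball_tendsto_0)
    qed
    ultimately have "((\<lambda>R. (?k + I v x (- ball 0 R) + ?T R) - I v x (- ball 0 R) - ?k) \<longlongrightarrow> 0 - 0 - ?k) at_top"
      by (intro tendsto_intros)
    then show ?thesis by (simp add: minus_divide_left)
  qed
  \<comment> \<open>The tails do not involve x, so uniqueness of their limit forces the discrepancy
    to be the same at every point.\<close>
  have l_eq: "(frac_p_laplacian c \<sigma> p v x - L x) / c = l" for x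
    unfolding l_def by (rule tendsto_unique [OF _ T_lim T_lim]) simp
  have "0 \<le> l"
  proof (rule tendsto_lowerbound)
    show "(?T \<longlongrightarrow> l) at_top" unfolding l_def by (rule T_lim)
    have T_nonneg: "0 \<le> T i R" for i R
      unfolding T set_lebesgue_integral_def by (rule Bochner_Integration.integral_nonneg) simp
    show "\<forall>\<^sub>F R in at_top. 0 \<le> ?T R"
      using eventually_gt_at_top [of 0]
    proof eventually_elim
      case (elim R)
      then have "(\<lambda>i. T i R) \<longlonglongrightarrow> ?T R" using T_conv by (simp add: convergent_LIMSEQ_iff)
      then show ?case using T_nonneg by (intro LIMSEQ_le_const) auto
    qed
  qed simp
  then have "0 \<le> c * l" using assms(5) by simp
  moreover have "(?T \<longlongrightarrow> l) at_top"
    using T_lim [of 0] by (simp only: l_eq)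
  moreover have "(\<lambda>i. frac_p_laplacian c \<sigma> p (u i) x) \<longlonglongrightarrow> frac_p_laplacian c \<sigma> p v x - c * l" for x
  proof -
    have "L x = frac_p_laplacian c \<sigma> p v x - c * l"
      using l_eq [of x] assms(5) by (simp add: field_simps)
    then show ?thesis using L [of x] by (simp only:)
  qed
  ultimately show ?thesis
    using T_conv by (intro exI [of _ "c * l"] exI [of _ l] conjI refl allI impI)
qed

end
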